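(* Let $D$ be an infinite, connected, distance-transitive, weakly descendant-homogeneous digraph of finite out-valency $m>1$ with no directed cycles. Suppose the reachability relation on the edges of $D$ is not universal and that the alternets of $D$ belong to $\mathcal{C}$. Then the relation $\delta$ on $D$ is non-trivial and the quotient digraph $D/\delta$ is a directed tree with out-valency $1$ and in-valency $k$, where $k$ is the number of $\delta$-classes in the set of sources of an alternet. In particular, if the alternets of $D$ are isomorphic to $\Sigma(m,M)$ for some integer $M\ge m$ or $M=\aleph_0$, then $D$ is isomorphic to $D(m,M)$.
   Context: Digraphs have no loops; subdigraphs are induced. An $s$-arc ($s\ge0$) from $u$ to $v$ is a sequence $u_0\dots u_s$ with $u_0=u$, $u_s=v$, $(u_i,u_{i+1})$ edges, and $u_{i-1}\ne u_{i+1}$ for $0<i<s$; $D^s(u)$ is the set of endpoints of $s$-arcs from $u$, $\mathrm{desc}(u)=\bigcup_sD^s(u)$, $\mathrm{desc}(X)=\bigcup_{x\in X}\mathrm{desc}(x)$. Distance-transitive: for each $s\ge0$, $\mathrm{Aut}(D)$ is transitive on pairs $(u,v)$ with an $s$-arc but no shorter arc from $u$ to $v$. Weakly descendant-homogeneous: vertex transitive, and for finite vertex sets $X,Y$ and any isomorphism $f$ between the induced subdigraphs on $\mathrm{desc}(X)$, $\mathrm{desc}(Y)$ there is an automorphism agreeing with $f$ on $X$. Directed cycle: $u_0,\dots,u_n=u_0$ ($n\ge1$) with consecutive edges. Alternating walk: $x_0\dots x_n$ such that either $(x_{2i-1},x_{2i})$ and $(x_{2i+1},x_{2i})$ are edges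 for all relevant $i$, or $(x_{2i},x_{2i-1})$ and $(x_{2i},x_{2i+1})$ are edges for all relevant $i$. Edge $e$ reaches $e'$ if some alternating walk $x_0\dots x_n$ has $e=(x_0,x_1)$, $e'\in\{(x_{n-1},x_n),(x_n,x_{n-1})\}$; this equivalence relation is universal if it has one class. An alternet is the subdigraph spanned by one class; its sources/sinks are the tails/heads of its edges. $\delta(u,v)$ iff $u,v$ have the same out-neighbours; $D/\delta$ has the $\delta$-classes as vertices and an edge $(\mathbf{a},\mathbf{b})$ iff some $a\in\mathbf{a},b\in\mathbf{b}$ form an edge. Class $\mathcal{C}$: bipartite digraphs with parts $X$ (sources), $Y$ (sinks), edges from $X$ to $Y$, no isolated vertices, $X,Y$ finite non-empty, edge transitive, $\delta$ non-trivial on $X$, and $|Y|$ equal to the size of the $\delta$-classes in $X$. For $m\ge1$ and $M$ an integer $\ge m$ or $M=\aleph_0$: let $\Omega$ be a set of size $M$ and $S$ the set of $m$-element subsets of $\Omega$. $\Sigma(m,M)$ is the bipartite digraph with sources $S\times\Omega$, sinks $\Omega$, and an edge from $(s,c)$ to $a$ iff $a\in s$. $D(m,M)$: let $T$ be the infinite regular directed tree with out-valency $1$ and in-valency $|S|$; for each vertex $t$ of $T$ fix a bijection between the in-neighbours of $t$ and $S$; $D(m,M)$ has vertex set $T\times\Omega$ and edges $((t',c),(t,a))$ for all edges $(t',t)$ of $T$, all $c\in\Omega$, and all $a$ in the $m$-subset corresponding to $t'$. *)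

theory Defs
  imports "Graph_Theory.Graph_Theory" "HOL-Library.Extended_Nat"
begin

section \<open>Isomorphisms and transitivity\<close>

text \<open>For digraphs without parallel arcs an isomorphism is a map of vertices. The library relation
  \<^const>\<open>digraph_iso\<close> says that there is one; see \<open>digraph_iso_iff\<close> below.\<close>

definition dg_isom :: "('a \<Rightarrow> 'c) \<Rightarrow> ('a, 'b) pre_digraph \<Rightarrow> ('c, 'd) pre_digraph \<Rightarrow> bool" where
  "dg_isom f G H \<longleftrightarrow> bij_betw f (verts G) (verts H) \<and>
     (\<forall>u\<in>verts G. \<forall>v\<in>verts G. u \<rightarrow>\<^bsub>G\<^esub> v \<longleftrightarrow> f u \<rightarrow>\<^bsub>H\<^esub> f v)"

definition automorphism :: "'a pair_pre_digraph \<Rightarrow> ('a \<Rightarrow> 'a) \<Rightarrow> bool" where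
  "automorphism D g \<longleftrightarrow> dg_isom g (with_proj D) (with_proj D)"

definition vertex_transitive :: "'a pair_pre_digraph \<Rightarrow> bool" where
  "vertex_transitive D \<longleftrightarrow>
     (\<forall>u\<in>pverts D. \<forall>v\<in>pverts D. \<exists>g. automorphism D g \<and> g u = v)"

definition edge_transitive :: "'a pair_pre_digraph \<Rightarrow> bool" where
  "edge_transitive D \<longleftrightarrow>
     (\<forall>(u, v)\<in>parcs D. \<forall>(u', v')\<in>parcs D. \<exists>g. automorphism D g \<and> g u = u' \<and> g v = v')"

section \<open>Arcs and descendants\<close>

definition s_arc :: "'a pair_pre_digraph \<Rightarrow> nat \<Rightarrow> 'a \<Rightarrow> 'a \<Rightarrow> 'a list \<Rightarrow> bool" where
  "s_arc D s u v xs \<longleftrightarrow> length xs = s + 1 \<and> set xs \<subseteq> pverts D \<and> xs ! 0 = u \<and> xs ! s = v \<and>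
     (\<forall>i<s. (xs ! i, xs ! (i + 1)) \<in> parcs D) \<and>
     (\<forall>i. 0 < i \<and> i < s \<longrightarrow> xs ! (i - 1) \<noteq> xs ! (i + 1))"

definition desc_at :: "'a pair_pre_digraph \<Rightarrow> nat \<Rightarrow> 'a \<Rightarrow> 'a set" where
  "desc_at D s u = {v. \<exists>xs. s_arc D s u v xs}"

definition desc :: "'a pair_pre_digraph \<Rightarrow> 'a \<Rightarrow> 'a set" where
  "desc D u = (\<Union>s. desc_at D s u)"

definition desc_set :: "'a pair_pre_digraph \<Rightarrow> 'a set \<Rightarrow> 'a set" where
  "desc_set D X = (\<Union>x\<in>X. desc D x)"

definition at_distance :: "'a pair_pre_digraph \<Rightarrow> nat \<Rightarrow> 'a \<Rightarrow> 'a \<Rightarrow> bool" where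
  "at_distance D s u v \<longleftrightarrow> v \<in> desc_at D s u \<and> (\<forall>r<s. v \<notin> desc_at D r u)"

definition distance_transitive :: "'a pair_pre_digraph \<Rightarrow> bool" where
  "distance_transitive D \<longleftrightarrow>
     (\<forall>s u v u' v'. at_distance D s u v \<and> at_distance D s u' v' \<longrightarrow>
        (\<exists>g. automorphism D g \<and> g u = u' \<and> g v = v'))"

definition weakly_descendant_homogeneous :: "'a pair_pre_digraph \<Rightarrow> bool" where
  "weakly_descendant_homogeneous D \<longleftrightarrow> vertex_transitive D \<and>
     (\<forall>X Y f. finite X \<and> X \<subseteq> pverts D \<and> finite Y \<and> Y \<subseteq> pverts D \<and>
        dg_isom f (with_proj D \<restriction> desc_set D X) (with_proj D \<restriction> desc_set D Y) \<longrightarrow>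
        (\<exists>g. automorphism D g \<and> (\<forall>x\<in>X. g x = f x)))"

section \<open>Valencies and directed trees\<close>

definition has_out_valency :: "'a pair_pre_digraph \<Rightarrow> nat \<Rightarrow> bool" where
  "has_out_valency D k \<longleftrightarrow>
     (\<forall>v\<in>pverts D. finite (out_arcs (with_proj D) v) \<and> out_degree (with_proj D) v = k)"

definition has_in_valency :: "'a pair_pre_digraph \<Rightarrow> nat \<Rightarrow> bool" where
  "has_in_valency D k \<longleftrightarrow>
     (\<forall>v\<in>pverts D. finite (in_arcs (with_proj D) v) \<and> in_degree (with_proj D) v = k)"

text \<open>A directed tree is an orientation of an undirected tree. The library's
  \<^const>\<open>tree\<close> does not express this: it only excludes directed cycles.\<close>

definition undirected_cycle :: "'a pair_pre_digraph \<Rightarrow> 'a list \<Rightarrow> bool" where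
  "undirected_cycle D xs \<longleftrightarrow> 3 \<le> length xs \<and> distinct xs \<and>
     (\<forall>i<length xs.
        (xs ! i, xs ! ((i + 1) mod length xs)) \<in> parcs (mk_symmetric (with_proj D)))"

definition directed_tree :: "'a pair_pre_digraph \<Rightarrow> bool" where
  "directed_tree D \<longleftrightarrow> pair_loopfree_digraph D \<and> connected (with_proj D) \<and>
     (\<forall>u v. (u, v) \<in> parcs D \<longrightarrow> (v, u) \<notin> parcs D) \<and> (\<nexists>xs. undirected_cycle D xs)"

section \<open>Reachability and alternets\<close>

text \<open>The vertices of the walk are \<open>xs ! 0, \<dots>, xs ! n\<close> with \<open>n = length xs - 1\<close>.\<close>

definition alternating_walk :: "'a pair_pre_digraph \<Rightarrow> 'a list \<Rightarrow> bool" where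
  "alternating_walk D xs \<longleftrightarrow> xs \<noteq> [] \<and> set xs \<subseteq> pverts D \<and>
     ((\<forall>i. (0 < i \<and> 2 * i < length xs \<longrightarrow> (xs ! (2 * i - 1), xs ! (2 * i)) \<in> parcs D) \<and>
           (2 * i + 1 < length xs \<longrightarrow> (xs ! (2 * i + 1), xs ! (2 * i)) \<in> parcs D)) \<or>
      (\<forall>i. (0 < i \<and> 2 * i < length xs \<longrightarrow> (xs ! (2 * i), xs ! (2 * i - 1)) \<in> parcs D) \<and>
           (2 * i + 1 < length xs \<longrightarrow> (xs ! (2 * i), xs ! (2 * i + 1)) \<in> parcs D)))"

definition edge_reach :: "'a pair_pre_digraph \<Rightarrow> ('a \<times> 'a) rel" where
  "edge_reach D = {(e, e'). e \<in> parcs D \<and> e' \<in> parcs D \<and>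
     (\<exists>xs n. alternating_walk D xs \<and> length xs = n + 1 \<and> 1 \<le> n \<and> e = (xs ! 0, xs ! 1) \<and>
        e' \<in> {(xs ! (n - 1), xs ! n), (xs ! n, xs ! (n - 1))})}"

definition reachability_universal :: "'a pair_pre_digraph \<Rightarrow> bool" where
  "reachability_universal D \<longleftrightarrow> (\<exists>C. parcs D // edge_reach D = {C})"

definition spanned_by :: "('a \<times> 'a) set \<Rightarrow> 'a pair_pre_digraph" where
  "spanned_by C = \<lparr>pverts = fst ` C \<union> snd ` C, parcs = C\<rparr>"

definition alternets :: "'a pair_pre_digraph \<Rightarrow> 'a pair_pre_digraph set" where
  "alternets D = spanned_by ` (parcs D // edge_reach D)"

definition sources :: "'a pair_pre_digraph \<Rightarrow> 'a set" where
  "sources A = fst ` parcs A"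

section \<open>The relation delta and the class C\<close>

definition delta :: "'a pair_pre_digraph \<Rightarrow> 'a rel" where
  "delta D = {(u, v). u \<in> pverts D \<and> v \<in> pverts D \<and> parcs D `` {u} = parcs D `` {v}}"

definition delta_nontrivial_on :: "'a pair_pre_digraph \<Rightarrow> 'a set \<Rightarrow> bool" where
  "delta_nontrivial_on D X \<longleftrightarrow> (\<exists>u\<in>X. \<exists>v\<in>X. u \<noteq> v \<and> (u, v) \<in> delta D)"

definition delta_quotient :: "'a pair_pre_digraph \<Rightarrow> 'a set pair_pre_digraph" where
  "delta_quotient D = \<lparr>pverts = pverts D // delta D,
     parcs = {(A, B). A \<in> pverts D // delta D \<and> B \<in> pverts D // delta D \<and>
                      (\<exists>a\<in>A. \<exists>b\<in>B. (a, b) \<in> parcs D)}\<rparr>"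

definition class_C :: "'a pair_pre_digraph \<Rightarrow> bool" where
  "class_C G \<longleftrightarrow> (\<exists>X Y. pverts G = X \<union> Y \<and> X \<inter> Y = {} \<and> parcs G \<subseteq> X \<times> Y \<and>
     (\<forall>v\<in>pverts G. \<exists>w. (v, w) \<in> parcs G \<or> (w, v) \<in> parcs G) \<and>
     finite X \<and> X \<noteq> {} \<and> finite Y \<and> Y \<noteq> {} \<and>
     edge_transitive G \<and> delta_nontrivial_on G X \<and>
     (\<forall>x\<in>X. card {x'\<in>X. (x, x') \<in> delta G} = card Y))"

section \<open>The digraphs Sigma(m,M) and D(m,M)\<close>

text \<open>\<open>M = \<infinity>\<close> stands for \<open>\<aleph>\<^sub>0\<close>: the set \<open>\<Omega>\<close> is
  \<open>{0, \<dots>, M - 1}\<close> for finite \<open>M\<close> and the set of all natural numbers for \<open>M = \<infinity>\<close>.\<close>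

definition Omega :: "enat \<Rightarrow> nat set" where
  "Omega M = {i. enat i < M}"

definition m_subsets :: "nat \<Rightarrow> enat \<Rightarrow> nat set set" where
  "m_subsets m M = {s. s \<subseteq> Omega M \<and> finite s \<and> card s = m}"

definition Sigma_digraph :: "nat \<Rightarrow> enat \<Rightarrow> ((nat set \<times> nat) + nat) pair_pre_digraph" where
  "Sigma_digraph m M =
     \<lparr>pverts = Inl ` (m_subsets m M \<times> Omega M) \<union> Inr ` Omega M,
      parcs = {(Inl (s, c), Inr a) | s c a. s \<in> m_subsets m M \<and> c \<in> Omega M \<and> a \<in> s}\<rparr>"

text \<open>The tree has out-valency 1 and, through the bijections, in-valency \<open>|S|\<close>, which
  is infinite for \<open>M = \<infinity>\<close> (recall \<open>m \<ge> 1\<close>).\<close>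

definition labelled_regular_tree ::
    "nat \<Rightarrow> enat \<Rightarrow> 't pair_pre_digraph \<Rightarrow> ('t \<Rightarrow> 't \<Rightarrow> nat set) \<Rightarrow> bool" where
  "labelled_regular_tree m M T \<phi> \<longleftrightarrow> directed_tree T \<and> infinite (pverts T) \<and>
     has_out_valency T 1 \<and>
     (\<forall>t\<in>pverts T. bij_betw (\<phi> t) {t'. (t', t) \<in> parcs T} (m_subsets m M))"

definition D_digraph ::
    "enat \<Rightarrow> 't pair_pre_digraph \<Rightarrow> ('t \<Rightarrow> 't \<Rightarrow> nat set) \<Rightarrow> ('t \<times> nat) pair_pre_digraph" where
  "D_digraph M T \<phi> =
     \<lparr>pverts = pverts T \<times> Omega M,
      parcs = {((t', c), (t, a)) | t' t c a. (t', t) \<in> parcs T \<and> c \<in> Omega M \<and> a \<in> \<phi> t t'}\<rparr>"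

section \<open>Sanity checks\<close>

lemma digraph_iso_iff:
  assumes "pair_wf_digraph G" "pair_wf_digraph H"
  shows "digraph_iso (with_proj G) (with_proj H) \<longleftrightarrow>
    (\<exists>f. dg_isom f (with_proj G) (with_proj H))"
proof
  assume "digraph_iso (with_proj G) (with_proj H)"
  then obtain h where h: "pre_digraph.digraph_isomorphism (with_proj G) h"
    and H: "with_proj H = app_iso h (with_proj G)"
    unfolding digraph_iso_def by blast
  let ?f = "iso_verts h"
  have inj: "inj_on ?f (pverts G)" and
    ends: "\<forall>a\<in>parcs G. ?f (fst a) = iso_tail h (iso_arcs h a) \<and> ?f (snd a) = iso_head h (iso_arcs h a)"
    using h unfolding pre_digraph.digraph_isomorphism_def by auto
  have V: "pverts H = ?f ` pverts G" and A: "parcs H = iso_arcs h ` parcs G"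
    and t: "iso_tail h = fst" and hd: "iso_head h = snd"
    using H by (metis verts_app_iso with_proj_simps(1), metis arcs_app_iso with_proj_simps(2),
      metis tail_app_iso with_proj_simps(4), metis head_app_iso with_proj_simps(5))
  have "iso_arcs h a = (?f (fst a), ?f (snd a))" if "a \<in> parcs G" for a
    using ends that by (simp add: t hd)
  then have A': "parcs H = (\<lambda>a. (?f (fst a), ?f (snd a))) ` parcs G"
    unfolding A by (rule image_cong[OF refl])
  have "dg_isom ?f (with_proj G) (with_proj H)"
    unfolding dg_isom_def bij_betw_def with_proj_simps
  proof (intro conjI ballI)
    show "inj_on ?f (pverts G)" by (rule inj)
    show "?f ` pverts G = pverts H" by (simp add: V)
    fix u v assume uv: "u \<in> pverts G" "v \<in> pverts G"
    show "(u, v) \<in> parcs G \<longleftrightarrow> (?f u, ?f v) \<in> parcs H"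
    proof
      assume "(u, v) \<in> parcs G"
      then show "(?f u, ?f v) \<in> parcs H" unfolding A' by force
    next
      assume "(?f u, ?f v) \<in> parcs H"
      then obtain a where a: "a \<in> parcs G" "?f (fst a) = ?f u" "?f (snd a) = ?f v"
        unfolding A' by auto
      then have "fst a = u" "snd a = v"
        using inj uv a pair_wf_digraph.arc_fst_in_verts[OF assms(1) a(1)]
          pair_wf_digraph.arc_snd_in_verts[OF assms(1) a(1)] by (auto dest: inj_onD)
      then show "(u, v) \<in> parcs G" using a(1) by auto
    qed
  qed
  then show "\<exists>f. dg_isom f (with_proj G) (with_proj H)" by blast
next
  assume "\<exists>f. dg_isom f (with_proj G) (with_proj H)"
  then obtain f where f: "bij_betw f (pverts G) (pverts H)"
    and e: "\<And>u v. u \<in> pverts G \<Longrightarrow> v \<in> pverts G \<Longrightarrow> (u, v) \<in> parcs G \<longleftrightarrow> (f u, f v) \<in> parcs H"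
    unfolding dg_isom_def by auto
  let ?h = "\<lparr>iso_verts = f, iso_arcs = map_prod f f, iso_head = snd, iso_tail = fst\<rparr>"
  have inj: "inj_on f (pverts G)" and V: "f ` pverts G = pverts H"
    using f by (auto simp: bij_betw_def)
  have sub: "parcs G \<subseteq> pverts G \<times> pverts G" "parcs H \<subseteq> pverts H \<times> pverts H"
    using assms unfolding pair_wf_digraph_def by (metis mem_Times_iff subsetI)+
  have A: "map_prod f f ` parcs G = parcs H"
  proof
    show "map_prod f f ` parcs G \<subseteq> parcs H" using sub e by auto
    show "parcs H \<subseteq> map_prod f f ` parcs G"
    proof
      fix p assume p: "p \<in> parcs H"
      then obtain u v where "u \<in> pverts G" "v \<in> pverts G" "p = (f u, f v)"
        using sub(2) unfolding V[symmetric] by auto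
      with e p have "(u, v) \<in> parcs G" by simp
      then show "p \<in> map_prod f f ` parcs G" using \<open>p = (f u, f v)\<close> by (metis map_prod_imageI)
    qed
  qed
  have "inj_on (map_prod f f) (parcs G)"
    by (rule inj_on_subset[OF map_prod_inj_on[OF inj inj] sub(1)])
  moreover have "wf_digraph (with_proj G)"
    using assms(1) by (simp add: wf_digraph_def pair_wf_digraph_def)
  ultimately have "pre_digraph.digraph_isomorphism (with_proj G) ?h"
    using inj unfolding pre_digraph.digraph_isomorphism_def by auto
  moreover have "with_proj H = app_iso ?h (with_proj G)"
    unfolding app_iso_def with_proj_def by (simp add: V A)
  ultimately show "digraph_iso (with_proj G) (with_proj H)"
    unfolding digraph_iso_def by blast
qed

text \<open>The tree and the bijections required by \<open>labelled_regular_tree\<close> exist. A vertex is a level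
  together with the labels read along its out-going ray.\<close>

lemma labelled_regular_tree_exists:
  assumes "enat m \<le> M"
  shows "\<exists>(T :: (int \<times> (int \<Rightarrow> nat set)) pair_pre_digraph) \<phi>. labelled_regular_tree m M T \<phi>"
proof -
  let ?S = "m_subsets m M"
  define s0 where "s0 = {..<m}"
  have "enat i < M" if "i < m" for i
    using assms that by (metis enat_ord_simps(2) less_le_trans)
  then have s0: "s0 \<in> ?S"
    unfolding s0_def m_subsets_def Omega_def by auto
  define V :: "(int \<times> (int \<Rightarrow> nat set)) set" where
    "V = {(k, f). range f \<subseteq> ?S \<and> (\<forall>j<k. f j = s0) \<and> finite {j. f j \<noteq> s0}}"
  define up :: "int \<times> (int \<Rightarrow> nat set) \<Rightarrow> int \<times> (int \<Rightarrow> nat set)" where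
    "up = (\<lambda>(k, f). (k + 1, f(k := s0)))"
  define T where "T = \<lparr>pverts = V, parcs = (\<lambda>x. (x, up x)) ` V\<rparr>"
  define \<phi> :: "int \<times> (int \<Rightarrow> nat set) \<Rightarrow> int \<times> (int \<Rightarrow> nat set) \<Rightarrow> nat set" where
    "\<phi> = (\<lambda>t t'. snd t' (fst t'))"
  have upd: "(k', f(j := s)) \<in> V"
    if "(k, f) \<in> V" "s \<in> ?S" "k' \<le> k + 1" "k' > j \<longrightarrow> s = s0" "k' \<le> k \<or> j = k" for k k' f j s
  proof -
    have "{i. (f(j := s)) i \<noteq> s0} \<subseteq> insert j {i. f i \<noteq> s0}" by auto
    moreover have "finite (insert j {i. f i \<noteq> s0})" using that(1) unfolding V_def by simp
    ultimately have "finite {i. (f(j := s)) i \<noteq> s0}" by (rule finite_subset)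
    moreover have "\<forall>i<k'. (f(j := s)) i = s0" using that unfolding V_def by auto
    moreover have "(f(j := s)) i \<in> ?S" for i using that(1,2) unfolding V_def by auto
    then have "range (f(j := s)) \<subseteq> ?S" by blast
    ultimately show ?thesis unfolding V_def by (simp only: mem_Collect_eq prod.case simp_thms)
  qed
  have up_V: "up x \<in> V" if "x \<in> V" for x
    using that s0 upd[of "fst x" "snd x" s0 "fst x + 1" "fst x"] by (cases x) (simp add: up_def)
  have fst_up: "fst (up x) = fst x + 1" for x
    by (cases x) (simp add: up_def)
  have E: "(x, y) \<in> parcs T \<longleftrightarrow> x \<in> V \<and> y = up x" for x y
    unfolding T_def by auto
  have VT: "pverts T = V" unfolding T_def by simp
  interpret T: pair_loopfree_digraph T
  proof
    fix e assume "e \<in> parcs T"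
    then obtain x where "x \<in> V" "e = (x, up x)" unfolding T_def by auto
    then show "fst e \<in> pverts T" "snd e \<in> pverts T" "fst e \<noteq> snd e"
      using up_V fst_up[of x] by (auto simp: VT)
  qed
  have sym: "(x, y) \<in> parcs (mk_symmetric (with_proj T)) \<longleftrightarrow> (x, y) \<in> parcs T \<or> (y, x) \<in> parcs T" for x y
    by (cases x, cases y) (auto simp: parcs_mk_symmetric Bex_def)
  have ray_V: "(up ^^ n) x \<in> V" if "x \<in> V" for n x
    by (induction n) (auto simp: that up_V)
  have ray: "x \<rightarrow>\<^sup>*\<^bsub>with_proj T\<^esub> (up ^^ n) x" if "x \<in> V" for n x
  proof (induction n)
    case 0
    then show ?case using that by (simp add: VT)
  next
    case (Suc n)
    have "((up ^^ n) x, (up ^^ Suc n) x) \<in> parcs T" using ray_V[OF that] by (simp add: E)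
    with Suc show ?case by (rule T.reachable_adj_trans)
  qed
  have ray_eq: "(up ^^ n) (k, f) = (k + int n, \<lambda>j. if k \<le> j \<and> j < k + int n then s0 else f j)" for n k f
    by (induction n) (auto simp: up_def fun_eq_iff)
  have base: "\<exists>n. \<forall>n'\<ge>n. (up ^^ n') (k, f) = (k + int n', \<lambda>_. s0)" if "(k, f) \<in> V" for k f
  proof -
    have fin: "finite {j. f j \<noteq> s0}" and low: "\<forall>j<k. f j = s0" using that unfolding V_def by auto
    obtain b where b: "\<forall>j\<in>{j. f j \<noteq> s0}. j \<le> b" using fin bdd_above_finite bdd_above_def by metis
    have "(up ^^ n') (k, f) = (k + int n', \<lambda>_. s0)" if "n' \<ge> nat (b + 1 - k)" for n'
      unfolding ray_eq using b low that by (auto simp: fun_eq_iff)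
    then show ?thesis by blast
  qed
  interpret S: pair_wf_digraph "mk_symmetric (with_proj T)" ..
  have conn: "connected (with_proj T)"
    unfolding connected_def strongly_connected_def
  proof (intro conjI ballI)
    have "(0, \<lambda>_. s0) \<in> V" using s0 unfolding V_def by auto
    then show "verts (with_proj (mk_symmetric (with_proj T))) \<noteq> {}" by (auto simp: VT)
    fix x y assume "x \<in> verts (with_proj (mk_symmetric (with_proj T)))"
      "y \<in> verts (with_proj (mk_symmetric (with_proj T)))"
    then have xy: "x \<in> V" "y \<in> V" by (auto simp: VT)
    obtain k f l g where xe: "x = (k, f)" and ye: "y = (l, g)" by (cases x, cases y)
    obtain a b where a: "\<forall>n\<ge>a. (up ^^ n) (k, f) = (k + int n, \<lambda>_. s0)"
      and b: "\<forall>n\<ge>b. (up ^^ n) (l, g) = (l + int n, \<lambda>_. s0)"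
      using base xy xe ye by metis
    define c where "c = max (k + int a) (l + int b)"
    have "(up ^^ nat (c - k)) x = (c, \<lambda>_. s0)" "(up ^^ nat (c - l)) y = (c, \<lambda>_. s0)"
      using a[rule_format, of "nat (c - k)"] b[rule_format, of "nat (c - l)"]
      unfolding xe ye c_def by (auto simp: nat_le_iff le_nat_iff)
    then have "x \<rightarrow>\<^sup>*\<^bsub>with_proj (mk_symmetric (with_proj T))\<^esub> (c, \<lambda>_. s0)"
      "y \<rightarrow>\<^sup>*\<^bsub>with_proj (mk_symmetric (with_proj T))\<^esub> (c, \<lambda>_. s0)"
      using ray xy T.reachable_mk_symmetricI by metis+
    moreover have "symmetric (with_proj (mk_symmetric (with_proj T)))"
      by (rule symmetric_mk_symmetric)
    ultimately show "x \<rightarrow>\<^sup>*\<^bsub>with_proj (mk_symmetric (with_proj T))\<^esub> y"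
      by (blast intro: S.reachable_trans symmetric_reachable)
  qed
  have nocyc: False if c: "undirected_cycle T xs" for xs
  proof -
    let ?n = "length xs"
    have n: "3 \<le> ?n" and d: "distinct xs"
      and adj: "\<And>i. i < ?n \<Longrightarrow> (xs ! i, xs ! ((i + 1) mod ?n)) \<in> parcs (mk_symmetric (with_proj T))"
      using c unfolding undirected_cycle_def by auto
    define i where "i = arg_min_on (\<lambda>i. fst (xs ! i)) {..<?n}"
    have i: "i < ?n" "\<And>j. j < ?n \<Longrightarrow> fst (xs ! i) \<le> fst (xs ! j)"
    proof -
      have ne: "{..<?n} \<noteq> {}" "finite {..<?n}" using n by (auto simp: lessThan_empty_iff)
      show "i < ?n" using arg_min_if_finite(1)[OF ne(2,1)] unfolding i_def by blast
      show "fst (xs ! i) \<le> fst (xs ! j)" if "j < ?n" for j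
        unfolding i_def by (rule arg_min_least[OF ne(2,1)]) (simp add: that)
    qed
    define p where "p = (if i = 0 then ?n - 1 else i - 1)"
    define q where "q = (i + 1) mod ?n"
    have p: "p < ?n" "(p + 1) mod ?n = i" using i(1) n unfolding p_def by auto
    have q: "q < ?n" using i(1) unfolding q_def by (metis i(1) mod_less_divisor not_less_zero neq0_conv)
    have pq: "p \<noteq> q"
    proof (cases "i + 1 < ?n")
      case True
      then show ?thesis using n i(1) unfolding p_def q_def by auto
    next
      case False
      then have "i + 1 = ?n" using i(1) by simp
      then show ?thesis using n unfolding p_def q_def by auto
    qed
    have "xs ! q = up (xs ! i)"
      using adj[OF i(1)] i(2)[OF q] fst_up[of "xs ! q"] unfolding sym E q_def by auto
    moreover have "xs ! p = up (xs ! i)"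
      using adj[OF p(1)] i(2)[OF p(1)] fst_up[of "xs ! p"] unfolding sym E p(2) by auto
    ultimately show False using d p(1) q pq by (metis nth_eq_iff_index_eq)
  qed
  have tree: "directed_tree T"
    unfolding directed_tree_def
  proof (intro conjI allI impI notI)
    show "pair_loopfree_digraph T" by unfold_locales
    show "connected (with_proj T)" by (rule conn)
    show "False" if "(u, v) \<in> parcs T" "(v, u) \<in> parcs T" for u v
      using that fst_up[of u] fst_up[of v] by (auto simp: E)
    show "False" if "\<exists>xs. undirected_cycle T xs" using that nocyc by blast
  qed
  have inf: "infinite V"
  proof
    assume "finite V"
    moreover have "range (\<lambda>k::int. (k, \<lambda>_::int. s0)) \<subseteq> V" using s0 unfolding V_def by auto
    moreover have "inj (\<lambda>k::int. (k, \<lambda>_::int. s0))" by (auto intro: injI)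
    ultimately show False by (metis finite_imageD finite_subset infinite_UNIV_int)
  qed
  have out: "has_out_valency T 1"
    unfolding has_out_valency_def out_degree_def
  proof (intro ballI)
    fix v assume "v \<in> pverts T"
    then have "out_arcs (with_proj T) v = {(v, up v)}"
      unfolding out_arcs_def by (auto simp: E VT)
    then show "finite (out_arcs (with_proj T) v) \<and> card (out_arcs (with_proj T) v) = 1" by simp
  qed
  have bij: "bij_betw (\<phi> t) {t'. (t', t) \<in> parcs T} ?S" if "t \<in> pverts T" for t
  proof -
    obtain k g where t: "t = (k, g)" by (cases t)
    have tV: "(k, g) \<in> V" using that t VT by simp
    then have g0: "g (k - 1) = s0" unfolding V_def by auto
    have nb: "{t'. (t', t) \<in> parcs T} = (\<lambda>s. (k - 1, g(k - 1 := s))) ` ?S"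
    proof (intro equalityI subsetI)
      fix t' assume "t' \<in> {t'. (t', t) \<in> parcs T}"
      then have t': "t' \<in> V" "t = up t'" by (auto simp: E)
      obtain l f where lf: "t' = (l, f)" by (cases t')
      have l: "l = k - 1" and "g = f(k - 1 := s0)" using t'(2) unfolding lf t up_def by auto
      then have "f = g(k - 1 := f (k - 1))" by auto
      moreover have "f (k - 1) \<in> ?S" using t'(1) unfolding lf V_def by auto
      ultimately show "t' \<in> (\<lambda>s. (k - 1, g(k - 1 := s))) ` ?S" unfolding lf l by blast
    next
      fix t' assume "t' \<in> (\<lambda>s. (k - 1, g(k - 1 := s))) ` ?S"
      then obtain s where s: "s \<in> ?S" "t' = (k - 1, g(k - 1 := s))" by auto
      have "t' \<in> V" unfolding s(2) by (rule upd[OF tV s(1)]) auto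
      moreover have "up t' = t" unfolding s(2) up_def t using g0 by auto
      ultimately show "t' \<in> {t'. (t', t) \<in> parcs T}" by (simp add: E)
    qed
    show ?thesis unfolding nb bij_betw_def \<phi>_def by (auto simp: inj_on_def image_image)
  qed
  have "labelled_regular_tree m M T \<phi>"
    unfolding labelled_regular_tree_def using tree inf out bij VT by blast
  then show ?thesis by blast
qed

end

theory Submission
  imports Defs "HOL-Library.Ramsey"
begin

text \<open>Call two vertices cosinks if they are joined by a chain of vertices in which consecutive ones
  have a common in-neighbour; two edges reach each other iff their heads are cosinks. If \<open>x\<close> and \<open>x'\<close>
  have the same out-neighbours and neither is a descendant of \<open>w\<close>, then moving \<open>x\<close> to \<open>x'\<close> and fixing
  everything else is an isomorphism from the descendants of \<open>{x, w}\<close> to those of \<open>{x', w}\<close>, so some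
  automorphism fixes \<open>w\<close> and maps \<open>x\<close> to \<open>x'\<close>. Choosing \<open>w\<close> to be a cosink of \<open>x\<close>, this shows that
  \<open>\<delta>\<close>-equivalent vertices are cosinks. The converse follows by counting if the alternets are in the
  class C, and from the fact that all \<open>m\<close>-sets of sinks are out-neighbourhoods if they are copies of
  Sigma(m,M). When the \<open>\<delta>\<close>-classes are exactly the sink sets of alternets, each of them has a single
  out-neighbour in the quotient, which is therefore a tree.

  The trees underlying D(m,M) and \<open>D/\<delta>\<close> are isomorphic as labelled trees once their labels agree
  along one ray of each, because a vertex is determined by the labels read on its way up to the ray.\<close>

section \<open>Connectedness, isomorphisms and automorphisms\<close>

lemma connected_iff_rtrancl:
  assumes "pair_wf_digraph G"
  shows "connected (with_proj G) \<longleftrightarrow> pverts G \<noteq> {} \<and>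
    (\<forall>u\<in>pverts G. \<forall>v\<in>pverts G. (u, v) \<in> (parcs G \<union> (parcs G)\<inverse>)\<^sup>*)"
proof -
  interpret pair_wf_digraph G by fact
  let ?R = "parcs G \<union> (parcs G)\<inverse>"
  have "(u, v) \<in> rtrancl_on (pverts G) ?R" if "(u, v) \<in> ?R\<^sup>*" "u \<in> pverts G" for u v
    using that by induction (auto dest: in_arcsD1 in_arcsD2 intro: rtrancl_on_into_rtrancl_on)
  moreover have "symcl (parcs G) = ?R" by (auto simp: symcl_def)
  ultimately have "(u, v) \<in> rtrancl_on (pverts G) ((parcs G)\<^sup>s) \<longleftrightarrow> (u, v) \<in> ?R\<^sup>*"
    if "u \<in> pverts G" for u v
    using that rtrancl_on_rtranclI by metis
  then show ?thesis by (simp add: connected_conv)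
qed

lemma dg_isom_parcs:
  assumes "pair_wf_digraph G" "pair_wf_digraph H" "dg_isom f (with_proj G) (with_proj H)"
  shows "parcs H = map_prod f f ` parcs G"
proof -
  interpret G: pair_wf_digraph G by fact
  interpret H: pair_wf_digraph H by fact
  have verts: "pverts H = f ` pverts G"
    and arcs: "\<And>u v. u \<in> pverts G \<Longrightarrow> v \<in> pverts G \<Longrightarrow> (u, v) \<in> parcs G \<longleftrightarrow> (f u, f v) \<in> parcs H"
    using assms(3) by (auto simp: dg_isom_def bij_betw_def)
  show ?thesis
  proof (intro equalityI subrelI)
    fix a b assume ab: "(a, b) \<in> parcs H"
    obtain u v where "u \<in> pverts G" "v \<in> pverts G" "a = f u" "b = f v"
      using H.in_arcsD1[OF ab] H.in_arcsD2[OF ab] unfolding verts by blast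
    then show "(a, b) \<in> map_prod f f ` parcs G"
      using ab arcs by auto
  next
    fix a b assume "(a, b) \<in> map_prod f f ` parcs G"
    then obtain u v where "(u, v) \<in> parcs G" "a = f u" "b = f v" by auto
    then show "(a, b) \<in> parcs H" using arcs G.in_arcsD1 G.in_arcsD2 by metis
  qed
qed

lemma automorphism_iff:
  "automorphism D g \<longleftrightarrow> bij_betw g (pverts D) (pverts D) \<and>
     (\<forall>u\<in>pverts D. \<forall>v\<in>pverts D. (u, v) \<in> parcs D \<longleftrightarrow> (g u, g v) \<in> parcs D)"
  by (simp add: automorphism_def dg_isom_def)

lemma automorphism_bij: "automorphism D g \<Longrightarrow> bij_betw g (pverts D) (pverts D)"
  by (simp add: automorphism_iff)

lemma automorphism_inj: "automorphism D g \<Longrightarrow> inj_on g (pverts D)"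
  by (rule bij_betw_imp_inj_on[OF automorphism_bij])

lemma Image_image_invariant:
  assumes g: "bij_betw g V V" and r: "r \<subseteq> V \<times> V" and "X \<subseteq> V"
    and invariant: "\<And>u v. u \<in> V \<Longrightarrow> v \<in> V \<Longrightarrow> (u, v) \<in> r \<longleftrightarrow> (g u, g v) \<in> r"
  shows "r `` (g ` X) = g ` (r `` X)"
proof (intro equalityI subsetI)
  fix w assume "w \<in> r `` (g ` X)"
  then obtain x where x: "x \<in> X" "(g x, w) \<in> r" by blast
  then obtain v where "v \<in> V" "w = g v" using r g by (auto simp: bij_betw_def)
  then show "w \<in> g ` (r `` X)" using x \<open>X \<subseteq> V\<close> invariant by blast
next
  fix w assume "w \<in> g ` (r `` X)"
  then show "w \<in> r `` (g ` X)" using r invariant by blast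
qed

context pair_wf_digraph
begin

lemma parcs_subset: "parcs G \<subseteq> pverts G \<times> pverts G"
  by (auto dest: in_arcsD1 in_arcsD2)

lemma automorphism_out_neighbours:
  assumes "automorphism G g" "X \<subseteq> pverts G"
  shows "parcs G `` (g ` X) = g ` (parcs G `` X)"
  by (rule Image_image_invariant[OF automorphism_bij[OF assms(1)] parcs_subset assms(2)])
    (use assms(1) in \<open>simp add: automorphism_iff\<close>)

lemma automorphism_in_neighbours:
  assumes "automorphism G g" "X \<subseteq> pverts G"
  shows "(parcs G)\<inverse> `` (g ` X) = g ` ((parcs G)\<inverse> `` X)"
proof -
  have "(parcs G)\<inverse> \<subseteq> pverts G \<times> pverts G" using parcs_subset by blast
  from Image_image_invariant[OF automorphism_bij[OF assms(1)] this assms(2)]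
  show ?thesis using assms(1) by (simp add: automorphism_iff)
qed

end

section \<open>Vertices with the same out-neighbours\<close>

lemma equiv_delta: "equiv (pverts D) (delta D)"
  by (intro equivI) (auto simp: delta_def refl_on_def sym_def trans_def)

lemma delta_refl: "v \<in> pverts D \<Longrightarrow> (v, v) \<in> delta D"
  by (simp add: delta_def)

lemma delta_sym: "(u, v) \<in> delta D \<Longrightarrow> (v, u) \<in> delta D"
  by (simp add: delta_def)

lemma delta_trans: "(u, v) \<in> delta D \<Longrightarrow> (v, w) \<in> delta D \<Longrightarrow> (u, w) \<in> delta D"
  by (simp add: delta_def)

lemma delta_in_pverts:
  assumes "(u, v) \<in> delta D"
  shows "u \<in> pverts D" "v \<in> pverts D"
  using assms by (simp_all add: delta_def)

lemma delta_class_subset_pverts: "delta D `` X \<subseteq> pverts D"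
  using delta_in_pverts(2) by auto

lemma delta_class_eq_iff:
  assumes "u \<in> pverts D" "v \<in> pverts D"
  shows "delta D `` {u} = delta D `` {v} \<longleftrightarrow> (u, v) \<in> delta D"
  by (rule eq_equiv_class_iff[OF equiv_delta assms])

lemma delta_class_of_mem:
  assumes "X \<in> pverts D // delta D" "v \<in> X"
  shows "X = delta D `` {v}"
  using assms equiv_class_eq[OF equiv_delta] by (metis Image_singleton_iff quotientE)

lemma delta_arc_iff: "(u, v) \<in> delta D \<Longrightarrow> (u, w) \<in> parcs D \<longleftrightarrow> (v, w) \<in> parcs D"
  by (auto simp: delta_def)

lemma delta_trancl_iff:
  assumes "(u, v) \<in> delta D"
  shows "(u, w) \<in> (parcs D)\<^sup>+ \<longleftrightarrow> (v, w) \<in> (parcs D)\<^sup>+"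
  using delta_arc_iff[OF assms] by (meson rtrancl_into_trancl2 tranclD)

lemma out_neighbours_delta_class:
  assumes "u \<in> pverts D"
  shows "parcs D `` (delta D `` {u}) = parcs D `` {u}"
  using assms by (auto simp: delta_def)

context pair_wf_digraph
begin

lemma automorphism_delta_iff:
  assumes "automorphism G g" "u \<in> pverts G" "v \<in> pverts G"
  shows "(u, v) \<in> delta G \<longleftrightarrow> (g u, g v) \<in> delta G"
proof -
  have image: "parcs G `` {g x} = g ` (parcs G `` {x})" if "x \<in> pverts G" for x
    using automorphism_out_neighbours[OF assms(1), of "{x}"] that by simp
  have "parcs G `` {x} \<subseteq> pverts G" for x using parcs_subset by blast
  then have "parcs G `` {g u} = parcs G `` {g v} \<longleftrightarrow> parcs G `` {u} = parcs G `` {v}"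
    unfolding image[OF assms(2)] image[OF assms(3)]
    by (intro inj_on_image_eq_iff[OF automorphism_inj[OF assms(1)]])
  moreover have "g u \<in> pverts G" "g v \<in> pverts G"
    using assms automorphism_bij bij_betw_apply by metis+
  ultimately show ?thesis using assms by (simp add: delta_def)
qed

lemma automorphism_delta_class:
  assumes "automorphism G g" "u \<in> pverts G"
  shows "delta G `` {g u} = g ` (delta G `` {u})"
proof -
  have "delta G \<subseteq> pverts G \<times> pverts G" by (auto dest: delta_in_pverts)
  from Image_image_invariant[OF automorphism_bij[OF assms(1)] this, of "{u}"]
  show ?thesis using assms automorphism_delta_iff by simp
qed

end

subsection \<open>The quotient digraph\<close>

lemma pverts_delta_quotient: "pverts (delta_quotient D) = (\<lambda>v. delta D `` {v}) ` pverts D"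
  by (auto simp: delta_quotient_def quotient_def)

lemma pair_wf_delta_quotient: "pair_wf_digraph (delta_quotient D)"
  by unfold_locales (auto simp: delta_quotient_def)

context pair_wf_digraph
begin

lemma parcs_delta_quotient_iff:
  "(A, B) \<in> parcs (delta_quotient G) \<longleftrightarrow>
     (\<exists>u v. (u, v) \<in> parcs G \<and> A = delta G `` {u} \<and> B = delta G `` {v})"
proof
  assume "(A, B) \<in> parcs (delta_quotient G)"
  then show "\<exists>u v. (u, v) \<in> parcs G \<and> A = delta G `` {u} \<and> B = delta G `` {v}"
    using delta_class_of_mem unfolding delta_quotient_def by fastforce
next
  assume "\<exists>u v. (u, v) \<in> parcs G \<and> A = delta G `` {u} \<and> B = delta G `` {v}"
  then obtain u v where arc: "(u, v) \<in> parcs G" and "A = delta G `` {u}" "B = delta G `` {v}"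
    by blast
  then have "u \<in> A" "v \<in> B" "A \<in> pverts G // delta G" "B \<in> pverts G // delta G"
    using in_arcsD1[OF arc] in_arcsD2[OF arc] delta_refl by (auto intro: quotientI)
  then show "(A, B) \<in> parcs (delta_quotient G)"
    using arc by (auto simp: delta_quotient_def)
qed

lemma delta_quotient_out_neighbours:
  assumes "u \<in> pverts G"
  shows "parcs (delta_quotient G) `` {delta G `` {u}} = (\<lambda>v. delta G `` {v}) ` (parcs G `` {u})"
proof -
  have "(u, v) \<in> parcs G" if "(u', v) \<in> parcs G" "delta G `` {u} = delta G `` {u'}" for u' v
    using that assms in_arcsD1 delta_class_eq_iff delta_arc_iff by metis
  then have "(delta G `` {u}, B) \<in> parcs (delta_quotient G) \<longleftrightarrow>
      (\<exists>v. (u, v) \<in> parcs G \<and> B = delta G `` {v})" for B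
    unfolding parcs_delta_quotient_iff by blast
  then show ?thesis by blast
qed

lemma delta_quotient_in_neighbours:
  assumes "v \<in> pverts G"
  shows "(parcs (delta_quotient G))\<inverse> `` {delta G `` {v}} =
    (\<lambda>u. delta G `` {u}) ` ((parcs G)\<inverse> `` (delta G `` {v}))"
proof -
  have "(v, v') \<in> delta G" if "(u, v') \<in> parcs G" "delta G `` {v} = delta G `` {v'}" for u v'
    using that assms in_arcsD2 delta_class_eq_iff by metis
  moreover have "delta G `` {v} = delta G `` {v'}" if "(v, v') \<in> delta G" for v'
    using that delta_class_eq_iff delta_in_pverts by metis
  ultimately have "(A, delta G `` {v}) \<in> parcs (delta_quotient G) \<longleftrightarrow>
      (\<exists>u v'. (u, v') \<in> parcs G \<and> A = delta G `` {u} \<and> (v, v') \<in> delta G)" for A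
    unfolding parcs_delta_quotient_iff by blast
  then show ?thesis by blast
qed

lemma delta_quotient_trancl_lift:
  assumes "(delta G `` {u}, B) \<in> (parcs (delta_quotient G))\<^sup>+" "u \<in> pverts G"
  shows "\<exists>v. (u, v) \<in> (parcs G)\<^sup>+ \<and> B = delta G `` {v}"
  using assms(1)
proof (induction rule: trancl_induct)
  case (base B)
  then show ?case using delta_quotient_out_neighbours[OF assms(2)] by blast
next
  case (step B C)
  then obtain v where v: "(u, v) \<in> (parcs G)\<^sup>+" "B = delta G `` {v}" by blast
  then have "v \<in> pverts G" using in_arcsD2 by (meson tranclE)
  then obtain w where "(v, w) \<in> parcs G" "C = delta G `` {w}"
    using delta_quotient_out_neighbours step.hyps(2) v(2) by blast
  then show ?case using trancl_into_trancl[OF v(1)] by blast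
qed

lemma acyclic_delta_quotient:
  assumes acyclic: "acyclic (parcs G)"
  shows "acyclic (parcs (delta_quotient G))"
proof (intro acyclicI allI notI)
  fix A assume cycle: "(A, A) \<in> (parcs (delta_quotient G))\<^sup>+"
  then obtain B where "(A, B) \<in> parcs (delta_quotient G)" by (meson tranclD)
  then obtain u where u: "u \<in> pverts G" "A = delta G `` {u}"
    using in_arcsD1 by (auto simp: parcs_delta_quotient_iff)
  then obtain v where v: "(u, v) \<in> (parcs G)\<^sup>+" "delta G `` {u} = delta G `` {v}"
    using delta_quotient_trancl_lift cycle by blast
  then have "(u, v) \<in> delta G" using u(1) delta_class_eq_iff in_arcsD2 by (metis tranclE)
  then have "(v, v) \<in> (parcs G)\<^sup>+" using v(1) delta_trancl_iff by metis
  then show False using acyclic by (simp add: acyclic_def)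
qed

end

lemma (in pair_wf_digraph) connected_delta_quotient:
  assumes "connected (with_proj G)"
  shows "connected (with_proj (delta_quotient G))"
proof -
  let ?Q = "delta_quotient G"
  have "(delta G `` {u}, delta G `` {v}) \<in> (parcs ?Q \<union> (parcs ?Q)\<inverse>)\<^sup>*"
    if "(u, v) \<in> (parcs G \<union> (parcs G)\<inverse>)\<^sup>*" for u v
    using that
  proof induction
    case (step v w)
    then have "(delta G `` {v}, delta G `` {w}) \<in> parcs ?Q \<union> (parcs ?Q)\<inverse>"
      by (auto simp: parcs_delta_quotient_iff)
    then show ?case using step.IH by (rule rtrancl_into_rtrancl[rotated])
  qed simp
  then show ?thesis
    using assms connected_iff_rtrancl[OF pair_wf_digraph_axioms]
      connected_iff_rtrancl[OF pair_wf_delta_quotient[of G]] by (simp add: pverts_delta_quotient)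
qed

section \<open>Reachability and alternets\<close>

definition cosink :: "'a pair_pre_digraph \<Rightarrow> 'a rel" where
  "cosink D = ((parcs D)\<inverse> O parcs D)\<^sup>+"

definition sinks :: "'a pair_pre_digraph \<Rightarrow> 'a set" where
  "sinks D = snd ` parcs D"

definition alternet :: "'a pair_pre_digraph \<Rightarrow> 'a \<Rightarrow> 'a pair_pre_digraph" where
  "alternet D y = spanned_by (parcs D \<inter> UNIV \<times> cosink D `` {y})"

lemma sym_cosink: "sym (cosink D)"
  unfolding cosink_def by (intro sym_trancl) (auto simp: sym_def)

lemma cosink_sym: "(x, y) \<in> cosink D \<Longrightarrow> (y, x) \<in> cosink D"
  using sym_cosink by (rule symD)

lemma cosink_trans: "(x, y) \<in> cosink D \<Longrightarrow> (y, z) \<in> cosink D \<Longrightarrow> (x, z) \<in> cosink D"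
  unfolding cosink_def by (rule trancl_trans)

lemma out_neighbours_cosink:
  assumes "(u, y) \<in> parcs D" "(u, z) \<in> parcs D"
  shows "(y, z) \<in> cosink D"
  unfolding cosink_def using assms by (intro r_into_trancl) blast

lemma Range_cosink: "Range (cosink D) \<subseteq> Range (parcs D)"
  unfolding cosink_def by auto

lemma (in pair_wf_digraph) cosink_in_pverts:
  assumes "(y, z) \<in> cosink G"
  shows "y \<in> pverts G" "z \<in> pverts G"
  using assms cosink_sym[OF assms] Range_cosink[of G] in_arcsD2 by blast+

lemma (in pair_wf_digraph) automorphism_cosink:
  assumes g: "automorphism G g" and "(y, z) \<in> cosink G"
  shows "(g y, g z) \<in> cosink G"
proof -
  have arcs: "(g u, g v) \<in> parcs G" if "(u, v) \<in> parcs G" for u v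
    using that g in_arcsD1[OF that] in_arcsD2[OF that] by (simp add: automorphism_iff)
  show ?thesis
    using assms(2) unfolding cosink_def
  proof induction
    case (base z)
    then show ?case using arcs by blast
  next
    case (step z w)
    then have "(g z, g w) \<in> (parcs G)\<inverse> O parcs G" using arcs by blast
    then show ?case using step.IH by (rule trancl_into_trancl[rotated])
  qed
qed

lemma pair_wf_alternet: "pair_wf_digraph (alternet D y)"
  by unfold_locales (auto simp: alternet_def spanned_by_def)

lemma parcs_alternet: "parcs (alternet D y) = parcs D \<inter> UNIV \<times> cosink D `` {y}"
  by (simp add: alternet_def spanned_by_def)

lemma sources_alternet: "sources (alternet D y) = (parcs D)\<inverse> `` (cosink D `` {y})"
  by (force simp: sources_def parcs_alternet)

lemma (in pair_wf_digraph) sources_alternet_subset: "sources (alternet G y) \<subseteq> pverts G"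
  by (auto simp: sources_alternet dest: in_arcsD1)

lemma sinks_alternet: "sinks (alternet D y) = cosink D `` {y}"
  using Range_cosink[of D] by (force simp: sinks_def parcs_alternet)

lemma pverts_alternet:
  "pverts (alternet D y) = sources (alternet D y) \<union> sinks (alternet D y)"
  by (simp add: alternet_def spanned_by_def sources_def sinks_def)

lemma alternet_out_neighbours:
  assumes "x \<in> sources (alternet D y)"
  shows "parcs (alternet D y) `` {x} = parcs D `` {x}"
  using assms out_neighbours_cosink cosink_trans
  unfolding sources_alternet parcs_alternet by fast

lemma (in pair_wf_digraph) delta_alternet_class:
  assumes x: "x \<in> sources (alternet G y)"
  shows "{x' \<in> sources (alternet G y). (x, x') \<in> delta (alternet G y)} = delta G `` {x}"
proof -
  have "x' \<in> sources (alternet G y)" if "(x, x') \<in> delta G" for x'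
    using that x by (auto simp: sources_alternet delta_arc_iff)
  moreover have "(x, x') \<in> delta (alternet G y) \<longleftrightarrow> (x, x') \<in> delta G"
    if x': "x' \<in> sources (alternet G y)" for x'
    using x x' sources_alternet_subset[of y] alternet_out_neighbours[OF x]
      alternet_out_neighbours[OF x'] by (auto simp: delta_def pverts_alternet)
  ultimately show ?thesis by blast
qed

locale oriented_graph = pair_wf_digraph G for G :: "'a pair_pre_digraph" +
  assumes asym_parcs: "asym (parcs G)"
begin

lemma zigzag_alternating_walk:
  assumes "\<And>i. i \<le> k \<Longrightarrow> (t i, h i) \<in> parcs G" "\<And>i. i \<le> k \<Longrightarrow> (t (Suc i), h i) \<in> parcs G"
  shows "alternating_walk G (map (\<lambda>j. if even j then t (j div 2) else h (j div 2)) [0..<2 * k + 3])"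
    (is "alternating_walk G ?xs")
proof -
  have nth: "?xs ! j = (if even j then t (j div 2) else h (j div 2))" if "j < 2 * k + 3" for j
    using that by (simp del: upt_Suc)
  have "t i \<in> pverts G" if "i \<le> Suc k" for i
    using that assms in_arcsD1 by (cases i) auto
  moreover have "h i \<in> pverts G" if "i \<le> k" for i
    using assms(1)[OF that] in_arcsD2 by blast
  ultimately have "set ?xs \<subseteq> pverts G" by (auto elim!: oddE)
  moreover have "(?xs ! (2 * i), ?xs ! (2 * i - 1)) \<in> parcs G" if "0 < i" "2 * i < length ?xs" for i
    using that nth assms(2)[of "i - 1"] by (cases i) (auto simp del: upt_Suc)
  moreover have "(?xs ! (2 * i), ?xs ! (2 * i + 1)) \<in> parcs G" if "2 * i + 1 < length ?xs" for i
    using that nth assms(1)[of i] by (simp del: upt_Suc)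
  moreover have "?xs \<noteq> []" by simp
  ultimately show ?thesis unfolding alternating_walk_def by blast
qed

lemma alternating_walk_arcs:
  assumes walk: "alternating_walk G xs" and arc: "(xs ! 0, xs ! 1) \<in> parcs G" and "1 < length xs"
  shows "2 * i + 1 < length xs \<Longrightarrow> (xs ! (2 * i), xs ! (2 * i + 1)) \<in> parcs G"
    "2 * i + 2 < length xs \<Longrightarrow> (xs ! (2 * i + 2), xs ! (2 * i + 1)) \<in> parcs G"
proof -
  have "(xs ! (2 * 0 + 1), xs ! (2 * 0)) \<notin> parcs G" "2 * 0 + 1 < length xs"
    using arc asym_parcs assms(3) by (auto dest: asymD)
  then have out: "\<forall>i. (0 < i \<and> 2 * i < length xs \<longrightarrow> (xs ! (2 * i), xs ! (2 * i - 1)) \<in> parcs G) \<and>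
      (2 * i + 1 < length xs \<longrightarrow> (xs ! (2 * i), xs ! (2 * i + 1)) \<in> parcs G)"
    using walk unfolding alternating_walk_def by blast
  then show "2 * i + 1 < length xs \<Longrightarrow> (xs ! (2 * i), xs ! (2 * i + 1)) \<in> parcs G" by blast
  show "2 * i + 2 < length xs \<Longrightarrow> (xs ! (2 * i + 2), xs ! (2 * i + 1)) \<in> parcs G"
    using out[rule_format, of "Suc i"] by simp
qed

lemma edge_reach_imp_cosink:
  assumes "((u, y), (v, z)) \<in> edge_reach G"
  shows "(y, z) \<in> cosink G"
proof -
  obtain xs n where uy: "(u, y) = (xs ! 0, xs ! 1)" "(u, y) \<in> parcs G"
    and vz: "(v, z) \<in> {(xs ! (n - 1), xs ! n), (xs ! n, xs ! (n - 1))}" "(v, z) \<in> parcs G"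
    and walk: "alternating_walk G xs" and len: "length xs = n + 1" "1 \<le> n"
    using assms by (auto simp: edge_reach_def)
  have arcs: "2 * i + 1 \<le> n \<Longrightarrow> (xs ! (2 * i), xs ! (2 * i + 1)) \<in> parcs G"
    "2 * i + 2 \<le> n \<Longrightarrow> (xs ! (2 * i + 2), xs ! (2 * i + 1)) \<in> parcs G" for i
    using alternating_walk_arcs[OF walk] uy len by simp_all
  have heads: "(y, xs ! (2 * i + 1)) \<in> cosink G" if "2 * i + 1 \<le> n" for i
    using that
  proof (induction i)
    case 0
    then show ?case using uy out_neighbours_cosink by auto
  next
    case (Suc i)
    have "(xs ! (2 * i + 1), xs ! (2 * Suc i + 1)) \<in> cosink G"
      using Suc.prems arcs(2)[of i] arcs(1)[of "Suc i"] out_neighbours_cosink by auto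
    then show ?case using Suc cosink_trans by simp
  qed
  have "\<exists>i. n = 2 * i + 1 \<or> n = 2 * i + 2" using len(2) by presburger
  then obtain i where i: "n = 2 * i + 1 \<or> n = 2 * i + 2" ..
  then have "z = xs ! (2 * i + 1)"
    using vz arcs[of i] asym_parcs by (auto dest: asymD)
  then show ?thesis using heads[of i] i by auto
qed

lemma cosink_imp_edge_reach:
  assumes "(y, z) \<in> cosink G" and uy: "(u, y) \<in> parcs G" and vz: "(v, z) \<in> parcs G"
  shows "((u, y), (v, z)) \<in> edge_reach G"
proof -
  obtain k h where h: "h 0 = y" "h k = z" and "\<forall>i<k. (h i, h (Suc i)) \<in> (parcs G)\<inverse> O parcs G"
    using assms(1) unfolding cosink_def trancl_power relpow_fun_conv by blast
  then have "\<forall>i<k. \<exists>w. (w, h i) \<in> parcs G \<and> (w, h (Suc i)) \<in> parcs G" by blast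
  then obtain w where w: "\<And>i. i < k \<Longrightarrow> (w i, h i) \<in> parcs G \<and> (w i, h (Suc i)) \<in> parcs G"
    by metis
  define t where "t i = (if i = 0 then u else if i = Suc k then v else w (i - 1))" for i
  let ?xs = "map (\<lambda>j. if even j then t (j div 2) else h (j div 2)) [0..<2 * k + 3]"
  have "(t i, h i) \<in> parcs G" "(t (Suc i), h i) \<in> parcs G" if "i \<le> k" for i
    using that uy vz h w[of "i - 1"] w[of i] by (auto simp: t_def)
  then have "alternating_walk G ?xs" by (rule zigzag_alternating_walk)
  moreover have "length ?xs = (2 * k + 2) + 1" by simp
  moreover have "(u, y) = (?xs ! 0, ?xs ! 1)" using h(1) by (simp add: t_def del: upt_Suc)
  moreover have "(v, z) = (?xs ! (2 * k + 2), ?xs ! (2 * k + 2 - 1))"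
    using h(2) by (simp add: t_def del: upt_Suc)
  ultimately show ?thesis
    using uy vz unfolding edge_reach_def
    by (intro CollectI case_prodI conjI exI[of _ ?xs] exI[of _ "2 * k + 2"]) auto
qed

lemma edge_reach_iff:
  "((u, y), (v, z)) \<in> edge_reach G \<longleftrightarrow>
     (u, y) \<in> parcs G \<and> (v, z) \<in> parcs G \<and> (y, z) \<in> cosink G"
proof -
  have "edge_reach G \<subseteq> parcs G \<times> parcs G" by (auto simp: edge_reach_def)
  then show ?thesis using edge_reach_imp_cosink cosink_imp_edge_reach by blast
qed

lemma alternets_eq: "alternets G = alternet G ` sinks G"
proof -
  have "edge_reach G `` {e} = parcs G \<inter> UNIV \<times> cosink G `` {snd e}" if "e \<in> parcs G" for e
    using that by (cases e) (auto simp: edge_reach_iff)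
  then have "spanned_by (edge_reach G `` {e}) = alternet G (snd e)" if "e \<in> parcs G" for e
    using that by (simp add: alternet_def)
  moreover have "alternets G = (\<lambda>e. spanned_by (edge_reach G `` {e})) ` parcs G"
    by (auto simp: alternets_def quotient_def)
  ultimately show ?thesis by (simp add: sinks_def image_image)
qed

end

section \<open>Descendants and weak descendant-homogeneity\<close>

lemma arcs_ends_induce:
  "(u, v) \<in> arcs_ends (with_proj D \<restriction> S) \<longleftrightarrow> u \<in> S \<and> v \<in> S \<and> (u, v) \<in> parcs D"
  by (auto simp: arcs_ends_conv image_iff)

context oriented_graph
begin

lemma desc_at_eq_relpow:
  assumes "u \<in> pverts G"
  shows "desc_at G s u = ((parcs G) ^^ s) `` {u}"
proof (intro equalityI subsetI)
  fix v assume "v \<in> desc_at G s u"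
  then obtain xs where "s_arc G s u v xs" by (auto simp: desc_at_def)
  then show "v \<in> ((parcs G) ^^ s) `` {u}"
    by (auto simp: s_arc_def relpow_fun_conv intro!: exI[of _ "(!) xs"])
next
  fix v assume "v \<in> ((parcs G) ^^ s) `` {u}"
  then obtain f where f: "f 0 = u" "f s = v" "\<And>i. i < s \<Longrightarrow> (f i, f (Suc i)) \<in> parcs G"
    by (auto simp: relpow_fun_conv)
  let ?xs = "map f [0..<Suc s]"
  have nth: "?xs ! i = f i" if "i \<le> s" for i
    using that by (simp del: upt_Suc)
  have "f i \<in> pverts G" if "i \<le> s" for i
    using that f(1) f(3)[of "i - 1"] assms by (cases i) (auto dest: in_arcsD2)
  moreover have "f (i - 1) \<noteq> f (i + 1)" if "0 < i" "i < s" for i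
    using f(3)[of "i - 1"] f(3)[of i] that asym_parcs by (cases i) (auto dest: asymD)
  ultimately have "s_arc G s u v ?xs"
    using f nth by (auto simp: s_arc_def simp del: upt_Suc)
  then show "v \<in> desc_at G s u" by (auto simp: desc_at_def)
qed

lemma desc_eq_rtrancl:
  assumes "u \<in> pverts G"
  shows "desc G u = (parcs G)\<^sup>* `` {u}"
  using desc_at_eq_relpow[OF assms] by (auto simp: desc_def rtrancl_power)

lemma desc_set_insert:
  assumes "x \<in> pverts G" "W \<subseteq> pverts G"
  shows "desc_set G (insert x W) = insert x ((parcs G)\<^sup>+ `` {x} \<union> (parcs G)\<^sup>* `` W)"
proof -
  have "desc_set G (insert x W) = (parcs G)\<^sup>* `` insert x W"
    using assms desc_eq_rtrancl by (auto simp: desc_set_def)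
  also have "\<dots> = insert x ((parcs G)\<^sup>+ `` {x} \<union> (parcs G)\<^sup>* `` W)"
    by (auto simp: rtrancl_eq_or_trancl)
  finally show ?thesis .
qed

lemma dg_isom_replace_delta:
  assumes delta: "(x, x') \<in> delta G" and closed: "parcs G `` Q \<subseteq> Q" and "x \<notin> Q" "x' \<notin> Q"
  shows "dg_isom (id(x := x')) (with_proj G \<restriction> insert x Q) (with_proj G \<restriction> insert x' Q)"
proof -
  let ?f = "id(x := x')"
  have "bij_betw ?f (insert x Q) (insert x' Q)"
    using assms(3,4) by (auto simp: bij_betw_def inj_on_def)
  moreover have "(u, v) \<in> parcs G \<longleftrightarrow> (?f u, ?f v) \<in> parcs G"
    if "u \<in> insert x Q" "v \<in> insert x Q" for u v
  proof (cases "v = x")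
    case True
    have "(x, x) \<notin> parcs G" "(x', x') \<notin> parcs G"
      using asym_parcs by (auto dest: asymD)
    then show ?thesis using True that assms(3,4) closed by auto
  next
    case False
    then show ?thesis using that assms(3) delta_arc_iff[OF delta] by auto
  qed
  moreover have "?f u \<in> insert x' Q" if "u \<in> insert x Q" for u
    using that by auto
  ultimately show ?thesis
    unfolding dg_isom_def induce_subgraph_verts arcs_ends_induce by blast
qed

end

locale acyclic_pair_digraph = pair_wf_digraph G for G :: "'a pair_pre_digraph" +
  assumes acyclic: "acyclic (parcs G)"
begin

lemma not_in_trancl: "(x, x) \<notin> (parcs G)\<^sup>+"
  using acyclic by (simp add: acyclic_def)

lemma delta_not_in_trancl: "(u, v) \<in> delta G \<Longrightarrow> (u, v) \<notin> (parcs G)\<^sup>+"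
  using delta_trancl_iff not_in_trancl by metis

end

sublocale acyclic_pair_digraph \<subseteq> oriented_graph
proof
  show "asym (parcs G)"
    using not_in_trancl by (meson asymI trancl.simps)
qed

locale acyclic_homogeneous_digraph = acyclic_pair_digraph G for G :: "'a pair_pre_digraph" +
  assumes homogeneous: "weakly_descendant_homogeneous G"
begin

lemma vertex_transitiveE:
  assumes "u \<in> pverts G" "v \<in> pverts G"
  obtains g where "automorphism G g" "g u = v"
  using assms homogeneous
  unfolding weakly_descendant_homogeneous_def vertex_transitive_def by blast

lemma weakly_descendant_homogeneousE:
  assumes "finite X" "X \<subseteq> pverts G" "finite Y" "Y \<subseteq> pverts G"
    and "dg_isom f (with_proj G \<restriction> desc_set G X) (with_proj G \<restriction> desc_set G Y)"
  obtains g where "automorphism G g" "\<forall>x\<in>X. g x = f x"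
  using assms homogeneous unfolding weakly_descendant_homogeneous_def by blast

lemma vertex_transitive_pairE:
  assumes "a \<in> pverts G" "b \<in> pverts G" "a \<noteq> b" "v \<in> pverts G"
  obtains g where "automorphism G g" "g a = v" "g b \<noteq> v"
proof -
  obtain g where "automorphism G g" "g a = v" using vertex_transitiveE assms by metis
  moreover from this have "g b \<noteq> v"
    using assms automorphism_inj by (metis inj_onD)
  ultimately show thesis using that by blast
qed

lemma delta_swapE:
  assumes delta: "(x, x') \<in> delta G" and W: "finite W" "W \<subseteq> pverts G"
    and above: "x \<notin> (parcs G)\<^sup>* `` W" "x' \<notin> (parcs G)\<^sup>* `` W"
  obtains g where "automorphism G g" "g x = x'" "\<And>w. w \<in> W \<Longrightarrow> g w = w"
proof -
  define Q where "Q = (parcs G)\<^sup>+ `` {x} \<union> (parcs G)\<^sup>* `` W"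
  note in_pverts = delta_in_pverts[OF delta]
  have same: "(parcs G)\<^sup>+ `` {x'} = (parcs G)\<^sup>+ `` {x}"
    using delta_trancl_iff[OF delta] by blast
  have "x \<notin> Q" "x' \<notin> Q"
    using above not_in_trancl delta_not_in_trancl[OF delta] by (auto simp: Q_def)
  moreover have "parcs G `` Q \<subseteq> Q"
    unfolding Q_def by (auto intro: trancl_into_trancl rtrancl_into_rtrancl)
  moreover have "desc_set G (insert x W) = insert x Q" "desc_set G (insert x' W) = insert x' Q"
    using desc_set_insert[OF in_pverts(1) W(2)] desc_set_insert[OF in_pverts(2) W(2)]
    by (simp_all only: Q_def same)
  ultimately have isom: "dg_isom (id(x := x')) (with_proj G \<restriction> desc_set G (insert x W))
      (with_proj G \<restriction> desc_set G (insert x' W))"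
    using dg_isom_replace_delta[OF delta] by simp
  have "finite (insert x W)" "insert x W \<subseteq> pverts G"
    "finite (insert x' W)" "insert x' W \<subseteq> pverts G"
    using in_pverts W by auto
  then obtain g where g: "automorphism G g" "\<forall>w\<in>insert x W. g w = (id(x := x')) w"
    using weakly_descendant_homogeneousE[OF _ _ _ _ isom] by blast
  have "g w = w" if "w \<in> W" for w
    using that g(2) above(1) by auto
  then show thesis using that[OF g(1)] g(2) by simp
qed

subsection \<open>Vertices with the same out-neighbours are sinks of the same alternet\<close>

lemma cosink_delta_dominates:
  assumes nontrivial: "delta_nontrivial_on G (pverts G)" and disjoint: "delta G \<inter> cosink G \<subseteq> Id"
    and wx: "(w, x) \<in> cosink G" "w \<noteq> x"
  shows "\<exists>x'. (x, x') \<in> delta G \<and> (w, x') \<in> (parcs G)\<^sup>+"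
proof (rule ccontr)
  assume not_dominated: "\<not> ?thesis"
  note in_pverts = cosink_in_pverts[OF wx(1)]
  obtain a b where ab: "(a, b) \<in> delta G" "a \<noteq> b"
    using nontrivial by (auto simp: delta_nontrivial_on_def)
  then obtain g where g: "automorphism G g" "g a = x" "g b \<noteq> x"
    using vertex_transitive_pairE delta_in_pverts in_pverts(2) by metis
  then obtain x' where x': "x' \<noteq> x" "(x, x') \<in> delta G"
    using automorphism_delta_iff[OF g(1) delta_in_pverts[OF ab(1)]] ab(1) by metis
  have "w \<noteq> x'" using disjoint x'(1) delta_sym[OF x'(2)] wx(1) by blast
  then have "x \<notin> (parcs G)\<^sup>* `` {w}" "x' \<notin> (parcs G)\<^sup>* `` {w}"
    using not_dominated wx(2) x'(2) delta_refl[OF in_pverts(2)] by (auto simp: rtrancl_eq_or_trancl)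
  then obtain g where "automorphism G g" "g x = x'" "g w = w"
    using delta_swapE[OF x'(2), of "{w}"] in_pverts(1) by auto
  then have "(w, x') \<in> cosink G" using automorphism_cosink wx(1) by metis
  then have "(x, x') \<in> cosink G" using wx(1) cosink_sym cosink_trans by metis
  then show False using disjoint x' by blast
qed

lemma ex_delta_cosink:
  assumes nontrivial: "delta_nontrivial_on G (pverts G)"
    and out: "(u, a) \<in> parcs G" "(u, b) \<in> parcs G" "a \<noteq> b"
  shows "\<exists>x y. x \<noteq> y \<and> (x, y) \<in> delta G \<and> (x, y) \<in> cosink G"
proof (rule ccontr)
  assume "\<not> ?thesis"
  then have "delta G \<inter> cosink G \<subseteq> Id" by auto
  note dominates = cosink_delta_dominates[OF nontrivial this]
  have "(a, b) \<in> cosink G" "(b, a) \<in> cosink G" using out out_neighbours_cosink by metis+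
  then obtain a' b' where "(b, b') \<in> delta G" "(a, b') \<in> (parcs G)\<^sup>+"
    and a': "(a, a') \<in> delta G" "(b, a') \<in> (parcs G)\<^sup>+"
    using dominates out(3) by metis
  then have "(a, a') \<in> (parcs G)\<^sup>+" using delta_trancl_iff by (metis trancl_trans)
  then show False using delta_not_in_trancl a'(1) by blast
qed

lemma delta_subset_cosinkI:
  assumes ab: "(a, b) \<in> delta G" "(a, b) \<in> cosink G" "a \<noteq> b"
  shows "delta G \<subseteq> cosink G"
proof (rule subrelI)
  fix y z assume yz: "(y, z) \<in> delta G"
  note in_pverts = delta_in_pverts[OF ab(1)] delta_in_pverts[OF yz]
  obtain g where g: "automorphism G g" "g a = y" "g b \<noteq> y"
    using vertex_transitive_pairE in_pverts ab(3) by metis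
  have yb: "(y, g b) \<in> delta G" "(y, g b) \<in> cosink G"
    using automorphism_delta_iff[OF g(1) in_pverts(1,2)] automorphism_cosink[OF g(1)]
      ab(1,2) g(2) by auto
  show "(y, z) \<in> cosink G"
  proof (cases "z = y")
    case True
    then show ?thesis using yb(2) cosink_sym cosink_trans by metis
  next
    case False
    have "(g b, z) \<in> delta G" using yb(1) yz delta_sym delta_trans by metis
    moreover have "g b \<notin> (parcs G)\<^sup>* `` {y}" "z \<notin> (parcs G)\<^sup>* `` {y}"
      using delta_not_in_trancl yb(1) yz g(3) False by (auto simp: rtrancl_eq_or_trancl)
    ultimately obtain h where "automorphism G h" "h (g b) = z" "h y = y"
      using delta_swapE[of "g b" z "{y}"] in_pverts(3) by auto
    then show ?thesis using automorphism_cosink yb(2) by metis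
  qed
qed

theorem delta_subset_cosink_of_fork:
  assumes "delta_nontrivial_on G (pverts G)" "(u, a) \<in> parcs G" "(u, b) \<in> parcs G" "a \<noteq> b"
  shows "delta G \<subseteq> cosink G"
  using ex_delta_cosink[OF assms] delta_subset_cosinkI by blast

end

section \<open>Valencies and directed trees\<close>

lemma has_out_valency_iff:
  "has_out_valency D k \<longleftrightarrow> (\<forall>v\<in>pverts D. finite (parcs D `` {v}) \<and> card (parcs D `` {v}) = k)"
proof -
  have "out_arcs (with_proj D) v = Pair v ` (parcs D `` {v})" for v
    by (auto simp: out_arcs_def)
  moreover have "inj_on (Pair v) (parcs D `` {v})" for v by (simp add: inj_on_def)
  ultimately show ?thesis
    by (simp add: has_out_valency_def out_degree_def card_image finite_image_iff)
qed

lemma has_in_valency_iff: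
  "has_in_valency D k \<longleftrightarrow>
     (\<forall>v\<in>pverts D. finite ((parcs D)\<inverse> `` {v}) \<and> card ((parcs D)\<inverse> `` {v}) = k)"
proof -
  have "in_arcs (with_proj D) v = (\<lambda>u. (u, v)) ` ((parcs D)\<inverse> `` {v})" for v
    by (auto simp: in_arcs_def)
  moreover have "inj_on (\<lambda>u. (u, v)) ((parcs D)\<inverse> `` {v})" for v by (simp add: inj_on_def)
  ultimately show ?thesis
    by (simp add: has_in_valency_def in_degree_def card_image finite_image_iff)
qed

lemma parcs_mk_symmetric_iff:
  "(x, y) \<in> parcs (mk_symmetric (with_proj T)) \<longleftrightarrow> (x, y) \<in> parcs T \<or> (y, x) \<in> parcs T"
  by (auto simp: parcs_mk_symmetric Bex_def)

lemma undirected_cycle_neighboursE: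
  assumes cycle: "undirected_cycle T xs" and z: "z \<in> set xs"
  obtains x y where "x \<in> set xs" "y \<in> set xs" "x \<noteq> y"
    "(x, z) \<in> parcs (mk_symmetric (with_proj T))" "(z, y) \<in> parcs (mk_symmetric (with_proj T))"
proof -
  let ?n = "length xs"
  have n: "3 \<le> ?n" and "distinct xs"
    and adj: "\<And>i. i < ?n \<Longrightarrow> (xs ! i, xs ! ((i + 1) mod ?n)) \<in> parcs (mk_symmetric (with_proj T))"
    using cycle by (auto simp: undirected_cycle_def)
  obtain i where i: "i < ?n" "xs ! i = z" using z by (metis in_set_conv_nth)
  define p q where "p = (if i = 0 then ?n - 1 else i - 1)" and "q = (i + 1) mod ?n"
  have p: "p < ?n" "(p + 1) mod ?n = i"
    using i(1) n by (auto simp: p_def)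
  have q: "q < ?n"
    unfolding q_def by (rule mod_less_divisor) (use n in linarith)
  have "p \<noteq> q"
    using i(1) n by (cases "i + 1 = ?n") (auto simp: p_def q_def)
  then have "xs ! p \<noteq> xs ! q" using \<open>distinct xs\<close> p(1) q nth_eq_iff_index_eq by blast
  moreover have "(xs ! p, z) \<in> parcs (mk_symmetric (with_proj T))"
    "(z, xs ! q) \<in> parcs (mk_symmetric (with_proj T))"
    using adj[OF p(1)] adj[OF i(1)] by (simp_all only: p(2) i(2) q_def)
  ultimately show thesis using that nth_mem[OF p(1)] nth_mem[OF q] by blast
qed

lemma no_undirected_cycleI:
  assumes sv: "single_valued (parcs T)" and acyclic: "acyclic (parcs T)"
  shows "\<not> undirected_cycle T xs"
proof
  assume cycle: "undirected_cycle T xs"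
  define r where "r = parcs T \<inter> set xs \<times> set xs"
  have "finite r" "acyclic r"
    unfolding r_def by (auto intro: acyclic_subset[OF acyclic])
  then have "wf r" by (rule finite_acyclic_wf)
  moreover have "set xs \<noteq> {}" using cycle by (auto simp: undirected_cycle_def)
  ultimately obtain z where z: "z \<in> set xs" and "\<And>x. (x, z) \<in> r \<Longrightarrow> x \<notin> set xs"
    by (rule wfE_min') blast
  then have minimal: "(x, z) \<notin> parcs T" if "x \<in> set xs" for x
    using that unfolding r_def by blast
  obtain x y where "x \<in> set xs" "y \<in> set xs" and "x \<noteq> y"
    and "(x, z) \<in> parcs T \<or> (z, x) \<in> parcs T" "(z, y) \<in> parcs T \<or> (y, z) \<in> parcs T"
    using undirected_cycle_neighboursE[OF cycle z] unfolding parcs_mk_symmetric_iff by metis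
  then have "(z, x) \<in> parcs T" "(z, y) \<in> parcs T" using minimal by blast+
  then show False using sv \<open>x \<noteq> y\<close> by (auto dest: single_valuedD)
qed

lemma directed_treeI:
  assumes "pair_wf_digraph T" "connected (with_proj T)" "single_valued (parcs T)" "acyclic (parcs T)"
  shows "directed_tree T"
proof -
  interpret pair_wf_digraph T by fact
  interpret acyclic_pair_digraph T using assms(4) by unfold_locales
  have "pair_loopfree_digraph T"
    by unfold_locales (use asym_parcs in \<open>auto dest: asymD\<close>)
  then show ?thesis
    using assms asym_parcs no_undirected_cycleI by (auto simp: directed_tree_def dest: asymD)
qed

lemma pcas_closed_nth:
  assumes "pcas u p u" "i < length p"
  shows "fst (p ! ((i + 1) mod length p)) = snd (p ! i)"
proof -
  have "snd (p ! i) = (if Suc i < length p then fst (p ! Suc i) else v)"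
    if "pcas u p v" "i < length p" for u v i and p :: "('a \<times> 'a) list"
    using that
  proof (induction p arbitrary: u i)
    case (Cons e p)
    then show ?case by (cases i; cases p) auto
  qed simp
  moreover have "fst (p ! 0) = u" using assms by (cases p) auto
  ultimately show ?thesis using assms by (cases "Suc i = length p") auto
qed

lemma directed_tree_acyclic:
  assumes tree: "directed_tree T"
  shows "acyclic (parcs T)"
proof (rule ccontr)
  interpret pair_loopfree_digraph T using tree by (simp add: directed_tree_def)
  assume "\<not> acyclic (parcs T)"
  then obtain x where "(x, x) \<in> (parcs T)\<^sup>+" by (auto simp: acyclic_def)
  then obtain q where "closed_w q"
    using reachable1_awalk by (auto simp: closed_w_def)
  then obtain u p where p: "awalk u p u" "distinct (tl (pawalk_verts u p))" "p \<noteq> []"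
    using closed_w_imp_cycle unfolding cycle_def by blast
  then have closed: "pcas u p u" and arcs: "\<And>i. i < length p \<Longrightarrow> p ! i \<in> parcs T"
    by (auto simp: awalk_def)
  have "0 < length p" using p(3) by simp
  then consider (loop) "length p = 1" | (digon) "length p = 2" | (long) "3 \<le> length p" by linarith
  then show False
  proof cases
    case loop
    then show False
      using arcs[of 0] pcas_closed_nth[OF closed, of 0] pair_no_loops[of "p ! 0"] by simp
  next
    case digon
    then have "p ! 1 = (snd (p ! 0), fst (p ! 0))"
      using pcas_closed_nth[OF closed, of 0] pcas_closed_nth[OF closed, of 1]
      by (simp add: prod_eq_iff)
    then have "(fst (p ! 0), snd (p ! 0)) \<in> parcs T" "(snd (p ! 0), fst (p ! 0)) \<in> parcs T"
      using digon arcs[of 0] arcs[of 1] by simp_all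
    then show False using tree unfolding directed_tree_def by blast
  next
    case long
    have "tl (pawalk_verts u p) = map snd p"
      using awalk_verts_conv'[OF closed] p(3) by simp
    moreover have "(snd (p ! i), snd (p ! ((i + 1) mod length p))) \<in> parcs T" if "i < length p" for i
      using arcs[of "(i + 1) mod length p"] p(3) by (simp flip: pcas_closed_nth[OF closed that])
    ultimately have "undirected_cycle T (map snd p)"
      using p(2,3) long by (simp add: undirected_cycle_def parcs_mk_symmetric_iff)
    then show False using tree unfolding directed_tree_def by blast
  qed
qed

subsection \<open>The quotient as a directed tree\<close>

lemma (in pair_wf_digraph) delta_quotient_out_neighbour:
  assumes sub: "cosink G \<subseteq> delta G" and uv: "(u, v) \<in> parcs G"
  shows "parcs (delta_quotient G) `` {delta G `` {u}} = {delta G `` {v}}"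
proof -
  have "delta G `` {w} = delta G `` {v}" if "(u, w) \<in> parcs G" for w
    using that sub out_neighbours_cosink[OF that uv] by (meson equiv_class_eq equiv_delta subsetD)
  then show ?thesis
    unfolding delta_quotient_out_neighbours[OF in_arcsD1[OF uv]] using uv by blast
qed

lemma (in acyclic_pair_digraph) delta_quotient_tree:
  assumes sub: "cosink G \<subseteq> delta G" and connected: "connected (with_proj G)"
    and out: "\<And>v. v \<in> pverts G \<Longrightarrow> parcs G `` {v} \<noteq> {}"
  shows "directed_tree (delta_quotient G)" "has_out_valency (delta_quotient G) 1"
proof -
  let ?Q = "delta_quotient G"
  have out_single: "\<exists>B. parcs ?Q `` {A} = {B}" if "A \<in> pverts ?Q" for A
    using that out delta_quotient_out_neighbour[OF sub] by (fastforce simp: pverts_delta_quotient)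
  then show "has_out_valency ?Q 1"
    unfolding has_out_valency_iff by fastforce
  have "single_valued (parcs ?Q)"
  proof (rule single_valuedI)
    fix A B C assume "(A, B) \<in> parcs ?Q" "(A, C) \<in> parcs ?Q"
    moreover from this have "A \<in> pverts ?Q" by (simp add: delta_quotient_def)
    ultimately show "B = C" using out_single by (metis Image_singleton_iff singletonD)
  qed
  then show "directed_tree ?Q"
    using pair_wf_delta_quotient connected_delta_quotient[OF connected]
      acyclic_delta_quotient[OF acyclic] by (intro directed_treeI)
qed

lemma (in pair_wf_digraph) card_delta_quotient_in_neighbours:
  assumes g: "automorphism G g" and v: "v \<in> pverts G"
  shows "card ((parcs (delta_quotient G))\<inverse> `` {delta G `` {g v}}) =
    card ((parcs (delta_quotient G))\<inverse> `` {delta G `` {v}})"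
proof -
  let ?in = "\<lambda>v. (parcs (delta_quotient G))\<inverse> `` {delta G `` {v}}"
  have gv: "g v \<in> pverts G" using automorphism_bij[OF g] v by (rule bij_betw_apply)
  have "?in (g v) = (\<lambda>u. delta G `` {g u}) ` ((parcs G)\<inverse> `` (delta G `` {v}))"
    using delta_quotient_in_neighbours[OF gv] automorphism_delta_class[OF g v]
      automorphism_in_neighbours[OF g delta_class_subset_pverts] by (simp add: image_image)
  also have "\<dots> = (\<lambda>u. g ` (delta G `` {u})) ` ((parcs G)\<inverse> `` (delta G `` {v}))"
    using automorphism_delta_class[OF g] in_arcsD1 by (intro image_cong) auto
  also have "\<dots> = (`) g ` ?in v"
    unfolding delta_quotient_in_neighbours[OF v] by (simp add: image_image)
  finally have "?in (g v) = (`) g ` ?in v" .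
  moreover have "inj_on ((`) g) (?in v)"
    by (rule inj_on_subset[OF inj_on_image_Pow[OF automorphism_inj[OF g]]])
      (auto simp: delta_quotient_in_neighbours[OF v] dest: delta_in_pverts)
  ultimately show ?thesis by (simp add: card_image)
qed

lemma (in pair_wf_digraph) delta_quotient_in_neighbours_alternet:
  assumes "delta G = cosink G" "y \<in> pverts G"
  shows "(parcs (delta_quotient G))\<inverse> `` {delta G `` {y}} =
    {delta G `` {x} | x. x \<in> sources (alternet G y)}"
  using delta_quotient_in_neighbours[OF assms(2)] unfolding sources_alternet assms(1) by blast

section \<open>Alternets in the class C\<close>

locale connected_acyclic_homogeneous_digraph = acyclic_homogeneous_digraph D
  for D :: "'a pair_pre_digraph" +
  fixes m :: nat
  assumes connected: "connected (with_proj D)"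
    and out_valency: "has_out_valency D m" "1 < m"
begin

lemma out_neighbours:
  assumes "v \<in> pverts D"
  shows "finite (parcs D `` {v})" "card (parcs D `` {v}) = m"
  using assms out_valency(1) by (auto simp: has_out_valency_iff)

lemma out_neighbours_nonempty: "v \<in> pverts D \<Longrightarrow> parcs D `` {v} \<noteq> {}"
  using out_neighbours(2) out_valency(2) by fastforce

lemma pverts_nonempty: "pverts D \<noteq> {}"
  using connected connected_iff_rtrancl[OF pair_wf_digraph_axioms] by blast

lemma ex_in_neighbour:
  assumes "v \<in> pverts D"
  shows "\<exists>u. (u, v) \<in> parcs D"
proof -
  obtain w where w: "(v, w) \<in> parcs D" using out_neighbours_nonempty[OF assms] by blast
  then obtain g where "automorphism D g" "g w = v" using vertex_transitiveE in_arcsD2 assms by metis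
  then have "(g v, v) \<in> parcs D"
    using w in_arcsD2[OF w] assms unfolding automorphism_iff by metis
  then show ?thesis by blast
qed

lemma alternets_eq_image: "alternets D = alternet D ` pverts D"
proof -
  have "sinks D = pverts D" using ex_in_neighbour by (force simp: sinks_def dest: in_arcsD2)
  then show ?thesis by (simp add: alternets_eq)
qed

lemma cosink_refl: "v \<in> pverts D \<Longrightarrow> (v, v) \<in> cosink D"
  using ex_in_neighbour out_neighbours_cosink by metis

lemma delta_subset_cosink:
  assumes "delta_nontrivial_on D (pverts D)"
  shows "delta D \<subseteq> cosink D"
proof -
  obtain u where u: "u \<in> pverts D" using pverts_nonempty by blast
  have "\<not> card (parcs D `` {u}) \<le> Suc 0" using out_neighbours[OF u] out_valency(2) by simp
  then obtain a b where "(u, a) \<in> parcs D" "(u, b) \<in> parcs D" "a \<noteq> b"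
    using card_le_Suc0_iff_eq[OF out_neighbours(1)[OF u]] by blast
  then show ?thesis by (rule delta_subset_cosink_of_fork[OF assms])
qed

end

lemma class_C_sources_sinks:
  assumes "class_C G"
  shows "finite (sources G)" "finite (sinks G)" "sources G \<noteq> {}"
    "delta_nontrivial_on G (sources G)"
    "\<And>x. x \<in> sources G \<Longrightarrow> card {x' \<in> sources G. (x, x') \<in> delta G} = card (sinks G)"
proof -
  obtain X Y where verts: "pverts G = X \<union> Y" "X \<inter> Y = {}" and arcs: "parcs G \<subseteq> X \<times> Y"
    and incident: "\<forall>v\<in>pverts G. \<exists>w. (v, w) \<in> parcs G \<or> (w, v) \<in> parcs G"
    and parts: "finite X" "X \<noteq> {}" "finite Y" "delta_nontrivial_on G X"
      "\<forall>x\<in>X. card {x' \<in> X. (x, x') \<in> delta G} = card Y"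
    using assms unfolding class_C_def by blast
  have "X = sources G" "Y = sinks G"
    using verts arcs incident by (force simp: sources_def sinks_def)+
  then show "finite (sources G)" "finite (sinks G)" "sources G \<noteq> {}"
    "delta_nontrivial_on G (sources G)"
    "\<And>x. x \<in> sources G \<Longrightarrow> card {x' \<in> sources G. (x, x') \<in> delta G} = card (sinks G)"
    using parts by simp_all
qed

context connected_acyclic_homogeneous_digraph
begin

context
  assumes class_C: "\<forall>A\<in>alternets D. class_C A"
begin

lemma class_C_alternet: "y \<in> pverts D \<Longrightarrow> class_C (alternet D y)"
  using class_C by (simp add: alternets_eq_image)

lemma class_C_delta_nontrivial: "delta_nontrivial_on D (pverts D)"
proof -
  obtain y where y: "y \<in> pverts D" using pverts_nonempty by blast
  obtain x x' where "x \<in> sources (alternet D y)" "x' \<in> sources (alternet D y)" "x \<noteq> x'"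
    "(x, x') \<in> delta (alternet D y)"
    using class_C_sources_sinks(4)[OF class_C_alternet[OF y]] by (auto simp: delta_nontrivial_on_def)
  then have "(x, x') \<in> delta D" "x \<noteq> x'" using delta_alternet_class by blast+
  then show ?thesis using delta_in_pverts unfolding delta_nontrivial_on_def by metis
qed

lemma class_C_card_delta_class:
  assumes "x \<in> sources (alternet D y)" "y \<in> pverts D"
  shows "card (delta D `` {x}) = card (cosink D `` {y})"
  using class_C_sources_sinks(5)[OF class_C_alternet[OF assms(2)] assms(1)]
  by (simp add: delta_alternet_class[OF assms(1)] sinks_alternet)

lemma class_C_delta_eq_cosink: "delta D = cosink D"
proof
  show delta_le: "delta D \<subseteq> cosink D" using class_C_delta_nontrivial by (rule delta_subset_cosink)
  show "cosink D \<subseteq> delta D"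
  proof (rule subrelI)
    fix y z assume yz: "(y, z) \<in> cosink D"
    then have y: "y \<in> pverts D" by (rule cosink_in_pverts)
    obtain x where x: "x \<in> sources (alternet D y)"
      using class_C_sources_sinks(3)[OF class_C_alternet[OF y]] by blast
    then have x_in: "x \<in> pverts D" using sources_alternet_subset by blast
    obtain g where g: "automorphism D g" "g x = y" using vertex_transitiveE[OF x_in y] .
    have "inj_on g (delta D `` {x})"
      using automorphism_inj[OF g(1)] delta_class_subset_pverts by (rule inj_on_subset)
    then have "card (delta D `` {y}) = card (cosink D `` {y})"
      using automorphism_delta_class[OF g(1) x_in] g(2) class_C_card_delta_class[OF x y]
      by (simp add: card_image)
    moreover have "finite (cosink D `` {y})"
      using class_C_sources_sinks(2)[OF class_C_alternet[OF y]] by (simp add: sinks_alternet)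
    ultimately have "delta D `` {y} = cosink D `` {y}"
      using delta_le by (intro card_subset_eq) auto
    then show "(y, z) \<in> delta D" using yz by blast
  qed
qed

lemma class_C_in_valency:
  "\<exists>k. has_in_valency (delta_quotient D) k \<and>
     (\<forall>A\<in>alternets D. card {delta D `` {x} | x. x \<in> sources A} = k)"
proof -
  let ?in = "\<lambda>y. (parcs (delta_quotient D))\<inverse> `` {delta D `` {y}}"
  note in_eq = delta_quotient_in_neighbours_alternet[OF class_C_delta_eq_cosink]
  obtain y\<^sub>0 where y\<^sub>0: "y\<^sub>0 \<in> pverts D" using pverts_nonempty by blast
  have card: "card (?in y) = card (?in y\<^sub>0)" if y: "y \<in> pverts D" for y
  proof -
    obtain g where "automorphism D g" "g y\<^sub>0 = y" using vertex_transitiveE[OF y\<^sub>0 y] .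
    then show ?thesis using card_delta_quotient_in_neighbours[OF _ y\<^sub>0] by blast
  qed
  moreover have "finite (?in y)" if y: "y \<in> pverts D" for y
    using class_C_sources_sinks(1)[OF class_C_alternet[OF y]] unfolding in_eq[OF y] by simp
  ultimately have "has_in_valency (delta_quotient D) (card (?in y\<^sub>0))"
    unfolding has_in_valency_iff pverts_delta_quotient by blast
  moreover have "card {delta D `` {x} | x. x \<in> sources (alternet D y)} = card (?in y\<^sub>0)"
    if y: "y \<in> pverts D" for y
    using card[OF y] unfolding in_eq[OF y] .
  ultimately show ?thesis unfolding alternets_eq_image by blast
qed

theorem class_C_delta_quotient_tree:
  "directed_tree (delta_quotient D)" "has_out_valency (delta_quotient D) 1"
  using delta_quotient_tree[OF _ connected out_neighbours_nonempty] class_C_delta_eq_cosink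
  by simp_all

end

end

section \<open>Uniqueness of labelled trees\<close>

lemma funpow_commute: "(f ^^ i) ((f ^^ j) x) = (f ^^ j) ((f ^^ i) x)"
proof -
  have "(f ^^ i) ((f ^^ j) x) = (f ^^ (i + j)) x" by (simp add: funpow_add)
  also have "\<dots> = (f ^^ (j + i)) x" by (simp only: add.commute)
  finally show ?thesis by (simp add: funpow_add)
qed

locale labelled_tree =
  fixes V :: "'t set" and up :: "'t \<Rightarrow> 't" and lab :: "'t \<Rightarrow> 'l" and S :: "'l set"
  assumes up_in: "t \<in> V \<Longrightarrow> up t \<in> V"
    and no_cycle: "t \<in> V \<Longrightarrow> (up ^^ Suc n) t \<noteq> t"
    and confluent: "s \<in> V \<Longrightarrow> t \<in> V \<Longrightarrow> \<exists>i j. (up ^^ i) s = (up ^^ j) t"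
    and lab_bij: "t \<in> V \<Longrightarrow> bij_betw lab {s \<in> V. up s = t} S"
begin

lemma funpow_up_in: "t \<in> V \<Longrightarrow> (up ^^ n) t \<in> V"
  by (induction n) (simp_all add: up_in)

lemma lab_in: "t \<in> V \<Longrightarrow> lab t \<in> S"
  using bij_betw_apply[OF lab_bij[OF up_in]] by blast

lemma funpow_up_inject:
  assumes "t \<in> V" "(up ^^ i) t = (up ^^ j) t"
  shows "i = j"
proof -
  have "\<not> i < j" if "(up ^^ i) t = (up ^^ j) t" for i j
  proof
    assume "i < j"
    then obtain d where "j = Suc d + i" by (metis add.commute add_Suc_right less_imp_Suc_add)
    then have "(up ^^ Suc d) ((up ^^ i) t) = (up ^^ i) t" using that by (simp add: funpow_add)
    then show False using no_cycle funpow_up_in[OF assms(1)] by blast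
  qed
  then show ?thesis using assms(2) by (metis linorder_neqE_nat)
qed

lemma eq_if_same_labels:
  assumes "v \<in> V" "w \<in> V" "(up ^^ k) v = (up ^^ k) w"
    and "\<And>j. j < k \<Longrightarrow> lab ((up ^^ j) v) = lab ((up ^^ j) w)"
  shows "v = w"
  using assms
proof (induction k arbitrary: v w)
  case (Suc k)
  have "lab ((up ^^ j) (up v)) = lab ((up ^^ j) (up w))" if "j < k" for j
    using Suc.prems(4)[of "Suc j"] that by (simp add: funpow_Suc_right del: funpow.simps)
  moreover have "(up ^^ k) (up v) = (up ^^ k) (up w)"
    using Suc.prems(3) by (simp add: funpow_Suc_right del: funpow.simps)
  ultimately have "up v = up w"
    using Suc.IH up_in Suc.prems(1,2) by blast
  moreover have "lab v = lab w" using Suc.prems(4)[of 0] by simp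
  ultimately show ?case
    using Suc.prems(1,2) bij_betw_imp_inj_on[OF lab_bij[OF up_in[OF Suc.prems(1)]]]
    by (auto dest: inj_onD)
qed simp

lemma ex_with_labels:
  assumes "t \<in> V" "\<And>j. j < k \<Longrightarrow> l j \<in> S"
  shows "\<exists>v\<in>V. (up ^^ k) v = t \<and> (\<forall>j<k. lab ((up ^^ j) v) = l j)"
  using assms(2)
proof (induction k arbitrary: l)
  case 0
  then show ?case using assms(1) by auto
next
  case (Suc k)
  have "\<exists>u\<in>V. (up ^^ k) u = t \<and> (\<forall>j<k. lab ((up ^^ j) u) = l (Suc j))"
    by (rule Suc.IH) (simp add: Suc.prems)
  then obtain u where u: "u \<in> V" "(up ^^ k) u = t" "\<And>j. j < k \<Longrightarrow> lab ((up ^^ j) u) = l (Suc j)"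
    by blast
  have "l 0 \<in> lab ` {v \<in> V. up v = u}"
    using bij_betw_imp_surj_on[OF lab_bij[OF u(1)]] Suc.prems[of 0] by simp
  then obtain v where v: "v \<in> V" "up v = u" "lab v = l 0" by auto
  have "lab ((up ^^ j) v) = l j" if "j < Suc k" for j
    using that u(3) v by (cases j) (simp_all add: funpow_Suc_right del: funpow.simps(2))
  moreover have "(up ^^ Suc k) v = t"
    using u(2) v(2) by (simp add: funpow_Suc_right del: funpow.simps)
  ultimately show ?case using v(1) by blast
qed

end

locale labelled_tree_pair =
  T: labelled_tree V up lab S + T': labelled_tree V' up' lab' S
  for V :: "'t set" and up and lab :: "'t \<Rightarrow> 'l" and V' :: "'s set" and up' and lab' and S +
  fixes a :: 't and a' :: 's
  assumes base_in: "a \<in> V" "a' \<in> V'"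
    and ray_labels: "lab ((up ^^ i) a) = lab' ((up' ^^ i) a')"
begin

definition corresponds :: "'t \<Rightarrow> 's \<Rightarrow> bool" where
  "corresponds v w \<longleftrightarrow> (\<exists>k i. (up ^^ k) v = (up ^^ i) a \<and> (up' ^^ k) w = (up' ^^ i) a') \<and>
     (\<forall>j. lab ((up ^^ j) v) = lab' ((up' ^^ j) w))"

lemma corresponds_lab: "corresponds v w \<Longrightarrow> lab v = lab' w"
  unfolding corresponds_def by (metis funpow_0)

lemma corresponds_up:
  assumes "corresponds v w"
  shows "corresponds (up v) (up' w)"
proof -
  obtain k i where "(up ^^ k) v = (up ^^ i) a" "(up' ^^ k) w = (up' ^^ i) a'"
    using assms by (auto simp: corresponds_def)
  then have "(up ^^ k) (up v) = (up ^^ Suc i) a" "(up' ^^ k) (up' w) = (up' ^^ Suc i) a'"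
    by (metis comp_apply funpow.simps(2) funpow_Suc_right)+
  moreover have "lab ((up ^^ j) (up v)) = lab' ((up' ^^ j) (up' w))" for j
    using assms unfolding corresponds_def by (metis comp_apply funpow_Suc_right)
  ultimately show ?thesis unfolding corresponds_def by blast
qed

lemma ex_corresponds:
  assumes v: "v \<in> V"
  shows "\<exists>w\<in>V'. corresponds v w"
proof -
  obtain k i where meet: "(up ^^ k) v = (up ^^ i) a" using T.confluent[OF v base_in(1)] by blast
  obtain w where w: "w \<in> V'" "(up' ^^ k) w = (up' ^^ i) a'"
    and low: "\<And>j. j < k \<Longrightarrow> lab' ((up' ^^ j) w) = lab ((up ^^ j) v)"
    using T'.ex_with_labels[OF T'.funpow_up_in[OF base_in(2)], of k "\<lambda>j. lab ((up ^^ j) v)"]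
      T.lab_in[OF T.funpow_up_in[OF v]] by blast
  have "lab ((up ^^ j) v) = lab' ((up' ^^ j) w)" for j
  proof (cases "j < k")
    case False
    then have "j = (j - k) + k" by simp
    then have "(up ^^ j) v = (up ^^ (j - k + i)) a" "(up' ^^ j) w = (up' ^^ (j - k + i)) a'"
      using meet w(2) by (metis comp_apply funpow_add)+
    then show ?thesis using ray_labels by simp
  qed (simp add: low)
  then show ?thesis using w meet unfolding corresponds_def by blast
qed

lemma corresponds_unique:
  assumes "v \<in> V" "w\<^sub>1 \<in> V'" "w\<^sub>2 \<in> V'" "corresponds v w\<^sub>1" "corresponds v w\<^sub>2"
  shows "w\<^sub>1 = w\<^sub>2"
proof -
  obtain k\<^sub>1 i\<^sub>1 where meet\<^sub>1: "(up ^^ k\<^sub>1) v = (up ^^ i\<^sub>1) a" "(up' ^^ k\<^sub>1) w\<^sub>1 = (up' ^^ i\<^sub>1) a'"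
    using assms(4) by (auto simp: corresponds_def)
  obtain k\<^sub>2 i\<^sub>2 where meet\<^sub>2: "(up ^^ k\<^sub>2) v = (up ^^ i\<^sub>2) a" "(up' ^^ k\<^sub>2) w\<^sub>2 = (up' ^^ i\<^sub>2) a'"
    using assms(5) by (auto simp: corresponds_def)
  have "(up ^^ (k\<^sub>2 + i\<^sub>1)) a = (up ^^ k\<^sub>2) ((up ^^ k\<^sub>1) v)" by (simp add: funpow_add meet\<^sub>1(1))
  also have "\<dots> = (up ^^ (k\<^sub>1 + i\<^sub>2)) a" by (subst funpow_commute) (simp add: funpow_add meet\<^sub>2(1))
  finally have exponents: "k\<^sub>2 + i\<^sub>1 = k\<^sub>1 + i\<^sub>2" using T.funpow_up_inject base_in(1) by blast
  have "(up' ^^ (k\<^sub>2 + k\<^sub>1)) w\<^sub>1 = (up' ^^ (k\<^sub>2 + i\<^sub>1)) a'" by (simp add: funpow_add meet\<^sub>1(2))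
  also have "\<dots> = (up' ^^ k\<^sub>1) ((up' ^^ k\<^sub>2) w\<^sub>2)" by (simp add: exponents funpow_add meet\<^sub>2(2))
  also have "\<dots> = (up' ^^ (k\<^sub>2 + k\<^sub>1)) w\<^sub>2" by (subst funpow_commute) (simp add: funpow_add)
  finally have "(up' ^^ (k\<^sub>2 + k\<^sub>1)) w\<^sub>1 = (up' ^^ (k\<^sub>2 + k\<^sub>1)) w\<^sub>2" .
  moreover have "lab' ((up' ^^ j) w\<^sub>1) = lab' ((up' ^^ j) w\<^sub>2)" for j
    using assms(4,5) by (simp add: corresponds_def)
  ultimately show ?thesis using T'.eq_if_same_labels assms(2,3) by blast
qed

theorem ex_isomorphism:
  "\<exists>h. bij_betw h V V' \<and> (\<forall>v\<in>V. h (up v) = up' (h v) \<and> lab' (h v) = lab v)"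
proof -
  interpret swapped: labelled_tree_pair V' up' lab' V up lab S a' a
    by unfold_locales (simp_all add: base_in ray_labels)
  have swap: "swapped.corresponds w v \<longleftrightarrow> corresponds v w" for v w
    unfolding corresponds_def swapped.corresponds_def by auto
  obtain h where h: "\<And>v. v \<in> V \<Longrightarrow> h v \<in> V'" "\<And>v. v \<in> V \<Longrightarrow> corresponds v (h v)"
    using ex_corresponds by metis
  have h_eq: "h v = w" if "v \<in> V" "w \<in> V'" "corresponds v w" for v w
    using corresponds_unique that h by blast
  have "bij_betw h V V'"
    unfolding bij_betw_def
  proof (intro conjI inj_onI equalityI subsetI)
    fix u v assume "u \<in> V" "v \<in> V" "h u = h v"
    then show "u = v" using swapped.corresponds_unique h by (metis swap)
  next
    fix w assume "w \<in> V'"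
    then obtain v where "v \<in> V" "corresponds v w" using swapped.ex_corresponds swap by blast
    then show "w \<in> h ` V" using h_eq \<open>w \<in> V'\<close> by blast
  qed (use h(1) in blast)
  moreover have "h (up v) = up' (h v)" if "v \<in> V" for v
    using h_eq[OF T.up_in T'.up_in corresponds_up] h that by blast
  ultimately show ?thesis using h(2) corresponds_lab by metis
qed

end

section \<open>Uniqueness of D(m,M)\<close>

lemma m_subsets_eq_nsets: "m_subsets m M = [Omega M]\<^bsup>m\<^esup>"
  by (simp add: m_subsets_def nsets_def)

lemma bij_betw_m_subsets:
  assumes "bij_betw p (Omega M) (Omega M)"
  shows "bij_betw ((`) p) (m_subsets m M) (m_subsets m M)"
  unfolding m_subsets_eq_nsets using assms by (rule bij_betw_nsets)

lemma nsets_permutationE: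
  assumes s: "s \<in> [U]\<^bsup>m\<^esup>" and s': "s' \<in> [U]\<^bsup>m\<^esup>"
  obtains p where "bij_betw p U U" "p ` s = s'"
proof -
  have fin: "finite s" "finite s'" "card s = card s'" and sub: "s \<subseteq> U" "s' \<subseteq> U"
    using s s' by (auto simp: nsets_def)
  let ?F = "s \<union> s'"
  obtain a where a: "bij_betw a s s'" using finite_same_card_bij fin by blast
  have "card (?F - s) = card (?F - s')" using fin by (simp add: card_Diff_subset)
  then obtain b where b: "bij_betw b (?F - s) (?F - s')"
    using fin by (metis finite_Diff finite_UnI finite_same_card_bij)
  define q where "q x = (if x \<in> ?F - s then b x else id x)" for x
  define p where "p x = (if x \<in> s then a x else q x)" for x
  have "bij_betw q ((?F - s) \<union> (U - ?F)) ((?F - s') \<union> (U - ?F))"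
    unfolding q_def by (rule bij_betw_disjoint_Un[OF b bij_betw_id]) auto
  moreover have "(?F - s) \<union> (U - ?F) = U - s" "(?F - s') \<union> (U - ?F) = U - s'"
    using sub by auto
  ultimately have "bij_betw q (U - s) (U - s')" by simp
  then have "bij_betw p (s \<union> (U - s)) (s' \<union> (U - s'))"
    unfolding p_def by (rule bij_betw_disjoint_Un[OF a]) auto
  then have "bij_betw p U U" using sub by (simp add: Un_absorb1)
  moreover have "p ` s = s'"
    using bij_betw_imp_surj_on[OF a] by (simp add: p_def cong: image_cong_simp)
  ultimately show thesis by (rule that)
qed

lemma pverts_D_digraph: "pverts (D_digraph M T \<phi>) = pverts T \<times> Omega M"
  by (simp add: D_digraph_def)

lemma parcs_D_digraph_iff:
  "((s, c), (t, a)) \<in> parcs (D_digraph M T \<phi>) \<longleftrightarrow> (s, t) \<in> parcs T \<and> c \<in> Omega M \<and> a \<in> \<phi> t s"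
  by (auto simp: D_digraph_def)

lemma labelled_regular_treeD:
  assumes "labelled_regular_tree m M T \<phi>"
  shows "pair_wf_digraph T" "\<And>t. t \<in> pverts T \<Longrightarrow> bij_betw (\<phi> t) ((parcs T)\<inverse> `` {t}) (m_subsets m M)"
    "\<And>s t. (s, t) \<in> parcs T \<Longrightarrow> \<phi> t s \<in> m_subsets m M"
proof -
  show wf: "pair_wf_digraph T"
    using assms unfolding labelled_regular_tree_def directed_tree_def pair_loopfree_digraph_def by blast
  have "(parcs T)\<inverse> `` {t} = {t'. (t', t) \<in> parcs T}" for t by blast
  then show bij: "bij_betw (\<phi> t) ((parcs T)\<inverse> `` {t}) (m_subsets m M)" if "t \<in> pverts T" for t
    using assms that by (simp add: labelled_regular_tree_def)
  show "\<phi> t s \<in> m_subsets m M" if "(s, t) \<in> parcs T" for s t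
    using bij_betw_apply[OF bij, of t s] that pair_wf_digraph.in_arcsD2[OF wf that] by blast
qed

lemma pair_wf_D_digraph:
  assumes "labelled_regular_tree m M T \<phi>"
  shows "pair_wf_digraph (D_digraph M T \<phi>)"
proof -
  interpret pair_wf_digraph T using assms by (rule labelled_regular_treeD)
  have "a \<in> Omega M" if "(s, t) \<in> parcs T" "a \<in> \<phi> t s" for s t a
    using labelled_regular_treeD(3)[OF assms that(1)] that(2) by (auto simp: m_subsets_def)
  then show ?thesis
    by unfold_locales (auto simp: D_digraph_def dest: in_arcsD1 in_arcsD2)
qed

lemma D_digraph_isomI:
  assumes h: "bij_betw h (pverts T) (pverts T')"
    and arcs: "\<And>s t. s \<in> pverts T \<Longrightarrow> t \<in> pverts T \<Longrightarrow> (s, t) \<in> parcs T \<longleftrightarrow> (h s, h t) \<in> parcs T'"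
    and \<pi>: "\<And>t. bij_betw (\<pi> t) (Omega M) (Omega M)"
    and sub: "\<And>s t. (s, t) \<in> parcs T \<Longrightarrow> \<phi> t s \<subseteq> Omega M"
    and labels: "\<And>s t. (s, t) \<in> parcs T \<Longrightarrow> \<phi>' (h t) (h s) = \<pi> t ` \<phi> t s"
  shows "dg_isom (\<lambda>(t, a). (h t, \<pi> t a)) (with_proj (D_digraph M T \<phi>)) (with_proj (D_digraph M T' \<phi>'))"
proof -
  let ?f = "\<lambda>(t, a). (h t, \<pi> t a)"
  have \<pi>_inj: "inj_on (\<pi> t) (Omega M)" and \<pi>_image: "\<pi> t ` Omega M = Omega M" for t
    using \<pi> by (simp_all add: bij_betw_def)
  have "bij_betw ?f (pverts T \<times> Omega M) (pverts T' \<times> Omega M)"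
    unfolding bij_betw_def
  proof
    show "inj_on ?f (pverts T \<times> Omega M)"
      using bij_betw_imp_inj_on[OF h] \<pi>_inj by (auto simp: inj_on_def)
    have "?f ` (pverts T \<times> Omega M) = (\<Union>t\<in>pverts T. {h t} \<times> \<pi> t ` Omega M)" by force
    also have "\<dots> = h ` pverts T \<times> Omega M" using \<pi>_image by auto
    finally show "?f ` (pverts T \<times> Omega M) = pverts T' \<times> Omega M"
      using h by (simp add: bij_betw_def)
  qed
  moreover have "((s, c), (t, a)) \<in> parcs (D_digraph M T \<phi>) \<longleftrightarrow>
      (?f (s, c), ?f (t, a)) \<in> parcs (D_digraph M T' \<phi>')"
    if in_pverts: "s \<in> pverts T" "t \<in> pverts T" and in_Omega: "c \<in> Omega M" "a \<in> Omega M" for s c t a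
  proof -
    have "\<pi> s c \<in> Omega M" using \<pi>_image in_Omega(1) by blast
    moreover have "\<pi> t a \<in> \<phi>' (h t) (h s) \<longleftrightarrow> a \<in> \<phi> t s" if arc: "(s, t) \<in> parcs T"
      using labels[OF arc] inj_on_image_mem_iff[OF \<pi>_inj in_Omega(2) sub[OF arc]] by simp
    ultimately show ?thesis using arcs[OF in_pverts] in_Omega by (auto simp: parcs_D_digraph_iff)
  qed
  ultimately show ?thesis by (auto simp: dg_isom_def pverts_D_digraph)
qed

definition parent :: "'t pair_pre_digraph \<Rightarrow> 't \<Rightarrow> 't" where
  "parent T s = (THE t. (s, t) \<in> parcs T)"

locale out_valency_one_tree =
  fixes T :: "'t pair_pre_digraph"
  assumes tree: "directed_tree T" and out_valency_one: "has_out_valency T 1"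

sublocale out_valency_one_tree \<subseteq> pair_loopfree_digraph T
  using tree by (simp add: directed_tree_def)

context out_valency_one_tree
begin

lemma arc_iff_parent: "(s, t) \<in> parcs T \<longleftrightarrow> s \<in> pverts T \<and> t = parent T s"
proof (cases "s \<in> pverts T")
  case True
  then have "card (parcs T `` {s}) = 1" using out_valency_one by (simp add: has_out_valency_iff)
  then obtain t' where "parcs T `` {s} = {t'}" by (rule card_1_singletonE)
  then have "(s, t) \<in> parcs T \<longleftrightarrow> t = t'" for t by blast
  then show ?thesis using True by (simp add: parent_def)
qed (auto dest: in_arcsD1)

lemma parent_in: "t \<in> pverts T \<Longrightarrow> parent T t \<in> pverts T"
  using arc_iff_parent in_arcsD2 by blast

lemma relpow_parent: "t \<in> pverts T \<Longrightarrow> (t, (parent T ^^ n) t) \<in> parcs T ^^ n"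
proof (induction n)
  case (Suc n)
  have "(parent T ^^ n) t \<in> pverts T"
    using Suc.prems by (induction n) (simp_all add: parent_in)
  then show ?case using Suc arc_iff_parent by auto
qed simp

lemma parent_no_cycle:
  assumes "t \<in> pverts T"
  shows "(parent T ^^ Suc n) t \<noteq> t"
proof
  assume "(parent T ^^ Suc n) t = t"
  then have "(t, t) \<in> (parcs T)\<^sup>+"
    unfolding trancl_power using relpow_parent[OF assms, of "Suc n"] by (metis zero_less_Suc)
  then show False using directed_tree_acyclic[OF tree] by (simp add: acyclic_def)
qed

lemma parent_confluent:
  assumes "s \<in> pverts T" "t \<in> pverts T"
  shows "\<exists>i j. (parent T ^^ i) s = (parent T ^^ j) t"
proof -
  have "(s, t) \<in> (parcs T \<union> (parcs T)\<inverse>)\<^sup>*"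
    using assms tree connected_iff_rtrancl[OF pair_wf_digraph_axioms] by (simp add: directed_tree_def)
  then show ?thesis
  proof induction
    case base
    then show ?case by blast
  next
    case (step t u)
    then obtain i j where ij: "(parent T ^^ i) s = (parent T ^^ j) t" by blast
    from step.hyps(2) show ?case
    proof
      assume "(t, u) \<in> parcs T"
      then have "(parent T ^^ Suc i) s = (parent T ^^ j) u"
        using ij by (simp add: arc_iff_parent funpow_swap1)
      then show ?case by blast
    next
      assume "(t, u) \<in> (parcs T)\<inverse>"
      then have "(parent T ^^ i) s = (parent T ^^ Suc j) u"
        using ij by (simp add: arc_iff_parent funpow_swap1)
      then show ?case by blast
    qed
  qed
qed

end

lemma labelled_regular_tree_imp_out_valency_one_tree:
  "labelled_regular_tree m M T \<phi> \<Longrightarrow> out_valency_one_tree T"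
  by (simp add: labelled_regular_tree_def out_valency_one_tree_def)

lemma labelled_regular_tree_imp_labelled_tree:
  assumes T: "labelled_regular_tree m M T \<phi>"
  shows "labelled_tree (pverts T) (parent T) (\<lambda>s. \<phi> (parent T s) s) (m_subsets m M)"
proof -
  interpret out_valency_one_tree T using T by (rule labelled_regular_tree_imp_out_valency_one_tree)
  have "bij_betw (\<lambda>s. \<phi> (parent T s) s) {s \<in> pverts T. parent T s = t} (m_subsets m M)"
    if t: "t \<in> pverts T" for t
  proof -
    have "(parcs T)\<inverse> `` {t} = {s \<in> pverts T. parent T s = t}" using arc_iff_parent by auto
    then have "bij_betw (\<phi> t) {s \<in> pverts T. parent T s = t} (m_subsets m M)"
      using labelled_regular_treeD(2)[OF T t] by simp
    then show ?thesis by (rule iffD1[OF bij_betw_cong, rotated]) simp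
  qed
  then show ?thesis
    by unfold_locales (simp_all add: parent_in parent_no_cycle parent_confluent del: funpow.simps)
qed

lemma labelled_regular_tree_relabel:
  assumes T: "labelled_regular_tree m M T \<phi>" and \<pi>: "\<And>t. bij_betw (\<pi> t) (Omega M) (Omega M)"
  shows "labelled_regular_tree m M T (\<lambda>t s. \<pi> t ` \<phi> t s)"
proof -
  have "bij_betw (\<lambda>s. \<pi> t ` \<phi> t s) {s. (s, t) \<in> parcs T} (m_subsets m M)" if "t \<in> pverts T" for t
    using bij_betw_trans[of "\<phi> t", OF _ bij_betw_m_subsets[OF \<pi>]] T that
    by (simp add: labelled_regular_tree_def comp_def)
  then show ?thesis using T by (simp add: labelled_regular_tree_def)
qed

text \<open>The labels of two trees need not agree along any ray, but they can be made to agree by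
  permuting \<open>\<Omega>\<close> at each vertex of the ray.\<close>

lemma relabel_ray:
  assumes T: "labelled_regular_tree m M T \<phi>" and a: "a \<in> pverts T"
    and l: "range l \<subseteq> m_subsets m M"
  shows "\<exists>\<pi>. (\<forall>t. bij_betw (\<pi> t) (Omega M) (Omega M)) \<and>
    (\<forall>i. \<pi> ((parent T ^^ Suc i) a) ` \<phi> ((parent T ^^ Suc i) a) ((parent T ^^ i) a) = l i)"
proof -
  interpret labelled_tree "pverts T" "parent T" "\<lambda>s. \<phi> (parent T s) s" "m_subsets m M"
    using T by (rule labelled_regular_tree_imp_labelled_tree)
  let ?ray = "\<lambda>i. (parent T ^^ i) a"
  have "\<exists>p. bij_betw p (Omega M) (Omega M) \<and> (\<forall>i. t = ?ray (Suc i) \<longrightarrow> p ` \<phi> t (?ray i) = l i)" for t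
  proof (cases "\<exists>i. t = ?ray (Suc i)")
    case True
    then obtain i where i: "t = ?ray (Suc i)" by blast
    have "\<phi> t (?ray i) \<in> m_subsets m M" using lab_in[OF funpow_up_in[OF a], of i] i by simp
    then obtain p where p: "bij_betw p (Omega M) (Omega M)" "p ` \<phi> t (?ray i) = l i"
      using nsets_permutationE l unfolding m_subsets_eq_nsets by (metis range_subsetD)
    have "p ` \<phi> t (?ray j) = l j" if "t = ?ray (Suc j)" for j
      using funpow_up_inject[OF a, of "Suc i" "Suc j"] that i p(2) by simp
    then show ?thesis using p(1) by blast
  next
    case False
    then show ?thesis using bij_betw_id by blast
  qed
  then have "\<exists>\<pi>. \<forall>t. bij_betw (\<pi> t) (Omega M) (Omega M) \<and>
      (\<forall>i. t = ?ray (Suc i) \<longrightarrow> \<pi> t ` \<phi> t (?ray i) = l i)" by (intro choice allI)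
  then obtain \<pi> where \<pi>: "\<forall>t. bij_betw (\<pi> t) (Omega M) (Omega M) \<and>
      (\<forall>i. t = ?ray (Suc i) \<longrightarrow> \<pi> t ` \<phi> t (?ray i) = l i)" ..
  then show ?thesis by (intro exI[of _ \<pi>]) blast
qed

theorem D_digraph_unique:
  assumes T: "labelled_regular_tree m M T \<phi>" and T': "labelled_regular_tree m M T' \<phi>'"
  shows "\<exists>f. dg_isom f (with_proj (D_digraph M T \<phi>)) (with_proj (D_digraph M T' \<phi>'))"
proof -
  interpret T: out_valency_one_tree T
    using T by (rule labelled_regular_tree_imp_out_valency_one_tree)
  interpret T': out_valency_one_tree T'
    using T' by (rule labelled_regular_tree_imp_out_valency_one_tree)
  interpret lab': labelled_tree "pverts T'" "parent T'" "\<lambda>s. \<phi>' (parent T' s) s" "m_subsets m M"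
    using T' by (rule labelled_regular_tree_imp_labelled_tree)
  have "pverts T \<noteq> {}" "pverts T' \<noteq> {}" using T T' by (auto simp: labelled_regular_tree_def)
  then obtain a a' where base: "a \<in> pverts T" "a' \<in> pverts T'" by blast
  have ray_labels_in: "range (\<lambda>i. \<phi>' ((parent T' ^^ Suc i) a') ((parent T' ^^ i) a')) \<subseteq> m_subsets m M"
    using lab'.lab_in[OF lab'.funpow_up_in[OF base(2)]] by auto
  obtain \<pi> where \<pi>: "\<And>t. bij_betw (\<pi> t) (Omega M) (Omega M)"
    and ray: "\<And>i. \<pi> ((parent T ^^ Suc i) a) ` \<phi> ((parent T ^^ Suc i) a) ((parent T ^^ i) a) =
      \<phi>' ((parent T' ^^ Suc i) a') ((parent T' ^^ i) a')"
    using relabel_ray[OF T base(1) ray_labels_in] by blast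
  let ?\<psi> = "\<lambda>t s. \<pi> t ` \<phi> t s"
  interpret lab: labelled_tree "pverts T" "parent T" "\<lambda>s. ?\<psi> (parent T s) s" "m_subsets m M"
    using labelled_regular_tree_relabel[OF T \<pi>] by (rule labelled_regular_tree_imp_labelled_tree)
  interpret labelled_tree_pair "pverts T" "parent T" "\<lambda>s. ?\<psi> (parent T s) s"
    "pverts T'" "parent T'" "\<lambda>s. \<phi>' (parent T' s) s" "m_subsets m M" a a'
    using base ray by unfold_locales simp_all
  obtain h where h: "bij_betw h (pverts T) (pverts T')"
    and up: "\<And>t. t \<in> pverts T \<Longrightarrow> h (parent T t) = parent T' (h t)"
    and labels: "\<And>t. t \<in> pverts T \<Longrightarrow> \<phi>' (parent T' (h t)) (h t) = ?\<psi> (parent T t) t"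
    using ex_isomorphism by blast
  have "(s, t) \<in> parcs T \<longleftrightarrow> (h s, h t) \<in> parcs T'" if "s \<in> pverts T" "t \<in> pverts T" for s t
    using that inj_on_eq_iff[OF bij_betw_imp_inj_on[OF h], of t "parent T s"] T.parent_in up
      bij_betw_apply[OF h] by (simp add: T.arc_iff_parent T'.arc_iff_parent)
  moreover have "\<phi>' (h t) (h s) = \<pi> t ` \<phi> t s" if "(s, t) \<in> parcs T" for s t
    using that up labels by (auto simp: T.arc_iff_parent)
  moreover have "\<phi> t s \<subseteq> Omega M" if "(s, t) \<in> parcs T" for s t
    using labelled_regular_treeD(3)[OF T that] by (simp add: m_subsets_def)
  ultimately have "dg_isom (\<lambda>(t, a). (h t, \<pi> t a))
      (with_proj (D_digraph M T \<phi>)) (with_proj (D_digraph M T' \<phi>'))"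
    using h \<pi> by (intro D_digraph_isomI)
  then show ?thesis by blast
qed

section \<open>Alternets isomorphic to Sigma(m,M)\<close>

lemma lessThan_in_m_subsets:
  assumes "enat m \<le> M"
  shows "{..<m} \<in> m_subsets m M"
proof -
  have "enat i < M" if "i < m" for i
    using assms that by (metis enat_ord_simps(2) less_le_trans)
  then show ?thesis by (auto simp: m_subsets_def Omega_def)
qed

lemma nsets_extendE:
  assumes "W \<in> [U]\<^bsup>m\<^esup>" "Z \<subseteq> U" "finite Z" "card Z \<le> m"
  obtains s where "s \<in> [U]\<^bsup>m\<^esup>" "Z \<subseteq> s"
proof -
  have W: "W \<subseteq> U" "finite (Z \<union> W)" "card W = m" using assms by (auto simp: nsets_def)
  then have "m \<le> card (Z \<union> W)" by (metis Un_upper2 card_mono)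
  then obtain s where s: "Z \<subseteq> s" "s \<subseteq> Z \<union> W" "card s = m"
    using exists_subset_between[OF assms(4) _ Un_upper1 W(2)] by blast
  have "s \<subseteq> U" "finite s" using s(2) assms(2) W(1) finite_subset[OF s(2) W(2)] by blast+
  then have "s \<in> [U]\<^bsup>m\<^esup>" using s(3) by (simp add: nsets_def)
  then show thesis using that s(1) by blast
qed

lemma pair_wf_Sigma: "pair_wf_digraph (Sigma_digraph m M)"
  by unfold_locales (auto simp: Sigma_digraph_def m_subsets_def)

lemma digraph_iso_SigmaE:
  assumes wf: "pair_wf_digraph A"
    and iso: "digraph_iso (with_proj A) (with_proj (Sigma_digraph m M))"
  obtains \<xi> \<eta> where "inj_on \<xi> (m_subsets m M \<times> Omega M)" "inj_on \<eta> (Omega M)"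
    "parcs A = {(\<xi> (s, c), \<eta> a) | s c a. s \<in> m_subsets m M \<and> c \<in> Omega M \<and> a \<in> s}"
proof -
  interpret pair_wf_digraph A by (rule wf)
  have "digraph_iso (with_proj (Sigma_digraph m M)) (with_proj A)"
    using wf_digraph_axioms iso by (rule digraph_iso_swap)
  then obtain h where h: "dg_isom h (with_proj (Sigma_digraph m M)) (with_proj A)"
    using digraph_iso_iff[OF pair_wf_Sigma wf] by blast
  then have "inj_on h (Inl ` (m_subsets m M \<times> Omega M) \<union> Inr ` Omega M)"
    by (simp add: dg_isom_def bij_betw_def Sigma_digraph_def)
  then have "inj_on (h \<circ> Inl) (m_subsets m M \<times> Omega M)" "inj_on (h \<circ> Inr) (Omega M)"
    by (auto simp: inj_on_def)
  moreover have "parcs A = {((h \<circ> Inl) (s, c), (h \<circ> Inr) a) | s c a.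
      s \<in> m_subsets m M \<and> c \<in> Omega M \<and> a \<in> s}"
    unfolding dg_isom_parcs[OF pair_wf_Sigma wf h] by (force simp: Sigma_digraph_def)
  ultimately show thesis by (rule that)
qed

lemma Sigma_coordinates:
  assumes m: "0 < m" "enat m \<le> M" and \<xi>: "inj_on \<xi> (m_subsets m M \<times> Omega M)"
    and arcs: "parcs A = {(\<xi> (s, c), \<eta> a) | s c a. s \<in> m_subsets m M \<and> c \<in> Omega M \<and> a \<in> s}"
  shows "sources A = \<xi> ` (m_subsets m M \<times> Omega M)" "sinks A = \<eta> ` Omega M"
    "\<And>s c. s \<in> m_subsets m M \<Longrightarrow> c \<in> Omega M \<Longrightarrow> parcs A `` {\<xi> (s, c)} = \<eta> ` s"
proof -
  have nonempty: "s \<noteq> {}" and sub: "s \<subseteq> Omega M" if "s \<in> m_subsets m M" for s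
    using that m(1) by (auto simp: m_subsets_def)
  show "sources A = \<xi> ` (m_subsets m M \<times> Omega M)"
    unfolding sources_def arcs using nonempty by force
  have covered: "\<exists>s\<in>m_subsets m M. a \<in> s" if "a \<in> Omega M" for a
    using nsets_extendE[of "{..<m}" "Omega M" m "{a}"] lessThan_in_m_subsets[OF m(2)] m(1) that
    by (auto simp: m_subsets_eq_nsets)
  show "sinks A = \<eta> ` Omega M"
  proof (intro equalityI subsetI)
    fix z assume "z \<in> sinks A"
    then obtain s a where "s \<in> m_subsets m M" "a \<in> s" "z = \<eta> a"
      unfolding sinks_def arcs by auto
    then show "z \<in> \<eta> ` Omega M" using sub by blast
  next
    fix z assume "z \<in> \<eta> ` Omega M"
    then obtain s a where "s \<in> m_subsets m M" "a \<in> s" "a \<in> Omega M" "z = \<eta> a"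
      using covered by blast
    then have "(\<xi> (s, a), z) \<in> parcs A" unfolding arcs by blast
    then show "z \<in> sinks A" by (force simp: sinks_def)
  qed
  show "parcs A `` {\<xi> (s, c)} = \<eta> ` s" if sc: "s \<in> m_subsets m M" "c \<in> Omega M" for s c
  proof -
    have "\<xi> (s, c) = \<xi> (s', c') \<longleftrightarrow> s' = s \<and> c' = c" if "s' \<in> m_subsets m M" "c' \<in> Omega M" for s' c'
      using inj_on_eq_iff[OF \<xi>, of "(s, c)" "(s', c')"] sc that by auto
    then show ?thesis unfolding arcs using sc by auto
  qed
qed

lemma (in acyclic_pair_digraph) infinite_pverts:
  assumes "pverts G \<noteq> {}" "\<And>v. v \<in> pverts G \<Longrightarrow> parcs G `` {v} \<noteq> {}"
  shows "infinite (pverts G)"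
proof
  assume "finite (pverts G)"
  then have "finite (parcs G)" using parcs_subset by (meson finite_SigmaI finite_subset)
  then have "wf ((parcs G)\<inverse>)" using acyclic by (rule finite_acyclic_wf_converse)
  then obtain v where "v \<in> pverts G" "\<And>w. (w, v) \<in> (parcs G)\<inverse> \<Longrightarrow> w \<notin> pverts G"
    using assms(1) by (rule wfE_min') blast
  then show False using assms(2) in_arcsD2 by blast
qed

lemma bij_betw_equiv_classes:
  assumes equiv: "equiv V r" and bij: "\<And>B. B \<in> V // r \<Longrightarrow> bij_betw (\<eta> B) I B"
  shows "bij_betw (\<lambda>(B, i). \<eta> B i) (V // r \<times> I) V"
  unfolding bij_betw_def
proof (intro conjI inj_onI equalityI subsetI)
  fix p q assume "p \<in> V // r \<times> I" "q \<in> V // r \<times> I" "(\<lambda>(B, i). \<eta> B i) p = (\<lambda>(B, i). \<eta> B i) q"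
  then obtain B i C j where p: "p = (B, i)" "B \<in> V // r" "i \<in> I"
    and q: "q = (C, j)" "C \<in> V // r" "j \<in> I" and same_image: "\<eta> B i = \<eta> C j" by auto
  have "B \<inter> C \<noteq> {}"
    using bij_betw_apply[OF bij[OF p(2)] p(3)] bij_betw_apply[OF bij[OF q(2)] q(3)] same_image by auto
  then have "B = C" using quotient_disj[OF equiv p(2) q(2)] by blast
  moreover from this have "i = j"
    using inj_onD[OF bij_betw_imp_inj_on[OF bij[OF q(2)]]] same_image p(3) q(3) by blast
  ultimately show "p = q" using p(1) q(1) by simp
next
  fix v assume "v \<in> V"
  then have class_v: "r `` {v} \<in> V // r" "v \<in> r `` {v}"
    using quotientI equiv_class_self[OF equiv] by fast+
  then obtain i where "i \<in> I" "v = \<eta> (r `` {v}) i"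
    using bij_betw_imp_surj_on[OF bij] by blast
  then show "v \<in> (\<lambda>(B, i). \<eta> B i) ` (V // r \<times> I)" using class_v(1) by force
next
  fix v assume "v \<in> (\<lambda>(B, i). \<eta> B i) ` (V // r \<times> I)"
  then obtain B i where B: "B \<in> V // r" "i \<in> I" "v = \<eta> B i" by auto
  then show "v \<in> V"
    using bij_betw_apply[OF bij[OF B(1)] B(2)] in_quotient_imp_subset[OF equiv B(1)] by blast
qed

locale Sigma_alternets_digraph = connected_acyclic_homogeneous_digraph D m
  for D :: "'a pair_pre_digraph" and m +
  fixes M :: enat
  assumes m_le_M: "enat m \<le> M"
    and alternets_Sigma:
      "\<forall>A\<in>alternets D. digraph_iso (with_proj A) (with_proj (Sigma_digraph m M))"
begin

lemma lessThan_subset_Omega: "{..<m} \<subseteq> Omega M"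
  using lessThan_in_m_subsets[OF m_le_M] by (simp add: m_subsets_def)

lemma zero_in_Omega: "0 \<in> Omega M"
  using lessThan_subset_Omega out_valency(2) by auto

definition alternet_coordinates :: "'a \<Rightarrow> (nat set \<times> nat \<Rightarrow> 'a) \<Rightarrow> (nat \<Rightarrow> 'a) \<Rightarrow> bool" where
  "alternet_coordinates y \<xi> \<eta> \<longleftrightarrow>
     inj_on \<xi> (m_subsets m M \<times> Omega M) \<and> bij_betw \<eta> (Omega M) (cosink D `` {y}) \<and>
     sources (alternet D y) = \<xi> ` (m_subsets m M \<times> Omega M) \<and>
     (\<forall>s\<in>m_subsets m M. \<forall>c\<in>Omega M. parcs D `` {\<xi> (s, c)} = \<eta> ` s)"

lemma alternet_coordinatesD:
  assumes "alternet_coordinates y \<xi> \<eta>"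
  shows "inj_on \<xi> (m_subsets m M \<times> Omega M)" "bij_betw \<eta> (Omega M) (cosink D `` {y})"
    "sources (alternet D y) = \<xi> ` (m_subsets m M \<times> Omega M)"
    "\<And>s c. s \<in> m_subsets m M \<Longrightarrow> c \<in> Omega M \<Longrightarrow> \<xi> (s, c) \<in> pverts D"
    "\<And>s c. s \<in> m_subsets m M \<Longrightarrow> c \<in> Omega M \<Longrightarrow> parcs D `` {\<xi> (s, c)} = \<eta> ` s"
  using assms sources_alternet_subset[of y] by (auto simp: alternet_coordinates_def)

lemma ex_alternet_coordinates:
  assumes y: "y \<in> pverts D"
  shows "\<exists>\<xi> \<eta>. alternet_coordinates y \<xi> \<eta>"
proof -
  let ?S = "m_subsets m M"
  have "digraph_iso (with_proj (alternet D y)) (with_proj (Sigma_digraph m M))"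
    using alternets_Sigma y by (simp add: alternets_eq_image)
  then obtain \<xi> \<eta> where \<xi>: "inj_on \<xi> (?S \<times> Omega M)" and \<eta>: "inj_on \<eta> (Omega M)"
    and arcs: "parcs (alternet D y) = {(\<xi> (s, c), \<eta> a) | s c a. s \<in> ?S \<and> c \<in> Omega M \<and> a \<in> s}"
    by (rule digraph_iso_SigmaE[OF pair_wf_alternet])
  have "0 < m" using out_valency(2) by simp
  note coordinates = Sigma_coordinates[OF this m_le_M \<xi> arcs]
  have "\<xi> (s, c) \<in> sources (alternet D y)" if "s \<in> ?S" "c \<in> Omega M" for s c
    using coordinates(1) that by blast
  then have "\<forall>s\<in>?S. \<forall>c\<in>Omega M. parcs D `` {\<xi> (s, c)} = \<eta> ` s"
    using alternet_out_neighbours coordinates(3) by metis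
  then have "alternet_coordinates y \<xi> \<eta>"
    using \<xi> \<eta> coordinates(1,2) by (simp add: alternet_coordinates_def bij_betw_def sinks_alternet)
  then show ?thesis by blast
qed

lemma alternet_coordinates_delta:
  assumes "alternet_coordinates y \<xi> \<eta>" "s \<in> m_subsets m M" "c \<in> Omega M" "d \<in> Omega M"
  shows "(\<xi> (s, c), \<xi> (s, d)) \<in> delta D"
  using alternet_coordinatesD(4,5)[OF assms(1)] assms(2-4) by (simp add: delta_def)

lemma ex_nset_delta_class:
  assumes y: "y \<in> pverts D"
  shows "\<exists>Z. Z \<in> [delta D `` {y}]\<^bsup>m\<^esup>"
proof -
  obtain z where z: "(y, z) \<in> parcs D" using out_neighbours_nonempty[OF y] by blast
  note z_in = in_arcsD2[OF z]
  obtain \<xi> \<eta> where coordinates: "alternet_coordinates z \<xi> \<eta>"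
    using ex_alternet_coordinates[OF z_in] by blast
  have "y \<in> sources (alternet D z)" using z cosink_refl[OF z_in] by (auto simp: sources_alternet)
  then obtain s c where s: "s \<in> m_subsets m M" and "c \<in> Omega M" "y = \<xi> (s, c)"
    unfolding alternet_coordinatesD(3)[OF coordinates] by auto
  then have "(\<lambda>i. \<xi> (s, i)) ` {..<m} \<subseteq> delta D `` {y}"
    using alternet_coordinates_delta[OF coordinates] lessThan_subset_Omega by blast
  moreover have "inj_on (\<lambda>i. \<xi> (s, i)) {..<m}"
  proof (rule inj_onI)
    fix i j assume "i \<in> {..<m}" "j \<in> {..<m}" "\<xi> (s, i) = \<xi> (s, j)"
    then show "i = j"
      using inj_onD[OF alternet_coordinatesD(1)[OF coordinates], of "(s, i)" "(s, j)"] s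
        lessThan_subset_Omega by blast
  qed
  ultimately have "(\<lambda>i. \<xi> (s, i)) ` {..<m} \<in> [delta D `` {y}]\<^bsup>m\<^esup>"
    by (simp add: nsets_def card_image)
  then show ?thesis ..
qed

lemma ex_source_of_sinks:
  assumes y: "y \<in> pverts D" and Z: "Z \<in> [cosink D `` {y}]\<^bsup>m\<^esup>"
  shows "\<exists>x\<in>pverts D. parcs D `` {x} = Z"
proof -
  obtain \<xi> \<eta> where coordinates: "alternet_coordinates y \<xi> \<eta>"
    using ex_alternet_coordinates[OF y] by blast
  note \<eta> = alternet_coordinatesD(2)[OF coordinates]
  have "Z \<in> [\<eta> ` Omega M]\<^bsup>m\<^esup>" using Z \<eta> by (simp add: bij_betw_def)
  then obtain s where "s \<in> m_subsets m M" "Z = \<eta> ` s"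
    using nset_image_obtains bij_betw_imp_inj_on[OF \<eta>] unfolding m_subsets_eq_nsets by metis
  then show ?thesis using alternet_coordinatesD(4,5)[OF coordinates] zero_in_Omega by blast
qed

lemma Sigma_delta_nontrivial: "delta_nontrivial_on D (pverts D)"
proof -
  obtain y where "y \<in> pverts D" using pverts_nonempty by blast
  then obtain Z where Z: "Z \<subseteq> delta D `` {y}" "finite Z" "card Z = m"
    using ex_nset_delta_class by (auto simp: nsets_def)
  have "\<not> card Z \<le> Suc 0" using Z(3) out_valency(2) by simp
  then obtain a b where ab: "a \<in> Z" "b \<in> Z" "a \<noteq> b" using card_le_Suc0_iff_eq[OF Z(2)] by blast
  then have "(y, a) \<in> delta D" "(y, b) \<in> delta D" using Z(1) by blast+
  then have "(a, b) \<in> delta D" using delta_sym delta_trans by metis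
  then show ?thesis
    using ab(3) delta_in_pverts unfolding delta_nontrivial_on_def by metis
qed

text \<open>Every \<open>m\<close>-set of sinks is an out-neighbourhood, and some \<open>m\<close>-set of sinks lies in a single
  \<open>\<delta>\<close>-class. By vertex transitivity all of them do.\<close>

lemma Sigma_cosink_subset_delta: "cosink D \<subseteq> delta D"
proof (rule subrelI)
  fix y z assume yz: "(y, z) \<in> cosink D"
  note in_pverts = cosink_in_pverts[OF yz]
  obtain Z where Z: "Z \<in> [delta D `` {y}]\<^bsup>m\<^esup>" using ex_nset_delta_class[OF in_pverts(1)] by blast
  have "delta D `` {y} \<subseteq> cosink D `` {y}" using delta_subset_cosink[OF Sigma_delta_nontrivial] by blast
  then have Z_sinks: "Z \<in> [cosink D `` {y}]\<^bsup>m\<^esup>" using Z nsets_mono by blast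
  moreover have "{y, z} \<subseteq> cosink D `` {y}" using yz cosink_refl[OF in_pverts(1)] by blast
  moreover have "card {y, z} \<le> m" using out_valency(2) by (cases "y = z") simp_all
  ultimately obtain W where "W \<in> [cosink D `` {y}]\<^bsup>m\<^esup>" "{y, z} \<subseteq> W"
    using nsets_extendE[of Z _ m "{y, z}"] by blast
  then obtain u u' where u: "u \<in> pverts D" "{y, z} \<subseteq> parcs D `` {u}"
    and u': "u' \<in> pverts D" "parcs D `` {u'} = Z"
    using ex_source_of_sinks[OF in_pverts(1)] Z_sinks by metis
  obtain g where g: "automorphism D g" "g u = u'" using vertex_transitiveE[OF u(1) u'(1)] .
  have "g ` (parcs D `` {u}) = Z"
    using automorphism_out_neighbours[OF g(1), of "{u}"] g(2) u(1) u'(2) by simp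
  then have "g y \<in> Z" "g z \<in> Z" using u(2) by blast+
  then have "(y, g y) \<in> delta D" "(y, g z) \<in> delta D" using Z by (auto simp: nsets_def)
  then have "(g y, g z) \<in> delta D" using delta_sym delta_trans by metis
  then show "(y, z) \<in> delta D" using automorphism_delta_iff[OF g(1) in_pverts] by simp
qed

lemma Sigma_delta_eq_cosink: "delta D = cosink D"
  using delta_subset_cosink[OF Sigma_delta_nontrivial] Sigma_cosink_subset_delta by blast

lemma ex_delta_class_labelling:
  assumes "B \<in> pverts (delta_quotient D)"
  shows "\<exists>\<eta>. bij_betw \<eta> (Omega M) B \<and>
    bij_betw (\<lambda>A. {a \<in> Omega M. \<eta> a \<in> parcs D `` A})
      ((parcs (delta_quotient D))\<inverse> `` {B}) (m_subsets m M)"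
proof -
  let ?S = "m_subsets m M"
  obtain y where y: "y \<in> pverts D" "B = delta D `` {y}"
    using assms by (auto simp: pverts_delta_quotient)
  obtain \<xi> \<eta> where coordinates: "alternet_coordinates y \<xi> \<eta>"
    using ex_alternet_coordinates[OF y(1)] by blast
  note \<eta> = alternet_coordinatesD(2)[OF coordinates]
  note source_in = alternet_coordinatesD(4)[OF coordinates]
  let ?label = "\<lambda>A. {a \<in> Omega M. \<eta> a \<in> parcs D `` A}"
  define source_class where "source_class s = delta D `` {\<xi> (s, 0)}" for s
  have label: "?label (source_class s) = s" if s: "s \<in> ?S" for s
  proof -
    have "s \<subseteq> Omega M" using s by (simp add: m_subsets_def)
    then have "{a \<in> Omega M. \<eta> a \<in> \<eta> ` s} = s"
      using inj_on_image_mem_iff[OF bij_betw_imp_inj_on[OF \<eta>]] by blast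
    moreover have "parcs D `` source_class s = \<eta> ` s"
      using alternet_coordinatesD(5)[OF coordinates s zero_in_Omega]
      by (simp add: source_class_def out_neighbours_delta_class[OF source_in[OF s zero_in_Omega]])
    ultimately show ?thesis by simp
  qed
  have "delta D `` {\<xi> (s, c)} = source_class s" if "s \<in> ?S" "c \<in> Omega M" for s c
    unfolding source_class_def
    using equiv_delta alternet_coordinates_delta[OF coordinates that zero_in_Omega]
    by (rule equiv_class_eq)
  then have "{delta D `` {x} | x. x \<in> \<xi> ` (?S \<times> Omega M)} = source_class ` ?S"
    using zero_in_Omega by blast
  then have "(parcs (delta_quotient D))\<inverse> `` {B} = source_class ` ?S"
    using delta_quotient_in_neighbours_alternet[OF Sigma_delta_eq_cosink y(1)] y(2)
      alternet_coordinatesD(3)[OF coordinates] by simp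
  then have "bij_betw ?label ((parcs (delta_quotient D))\<inverse> `` {B}) ?S"
    by (intro bij_betw_byWitness[where f' = source_class]) (auto simp: label)
  moreover have "bij_betw \<eta> (Omega M) B" using \<eta> y(2) Sigma_delta_eq_cosink by simp
  ultimately show ?thesis by blast
qed

lemma infinite_delta_quotient: "infinite (pverts (delta_quotient D))"
proof -
  interpret Q: pair_wf_digraph "delta_quotient D" by (rule pair_wf_delta_quotient)
  interpret Q: acyclic_pair_digraph "delta_quotient D"
    using acyclic_delta_quotient[OF acyclic] by unfold_locales
  have "parcs (delta_quotient D) `` {delta D `` {v}} \<noteq> {}" if "v \<in> pverts D" for v
    using that delta_quotient_out_neighbours out_neighbours_nonempty by simp
  then show ?thesis
    using Q.infinite_pverts pverts_nonempty by (auto simp: pverts_delta_quotient)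
qed

theorem ex_D_digraph_delta_quotient:
  "\<exists>\<psi> f. labelled_regular_tree m M (delta_quotient D) \<psi> \<and>
     dg_isom f (with_proj (D_digraph M (delta_quotient D) \<psi>)) (with_proj D)"
proof -
  let ?Q = "delta_quotient D"
  obtain \<eta> where \<eta>: "\<forall>B\<in>pverts ?Q. bij_betw (\<eta> B) (Omega M) B \<and>
    bij_betw (\<lambda>A. {a \<in> Omega M. \<eta> B a \<in> parcs D `` A}) ((parcs ?Q)\<inverse> `` {B}) (m_subsets m M)"
    using bchoice[OF ballI[OF ex_delta_class_labelling]] ..
  define \<psi> where "\<psi> B A = {a \<in> Omega M. \<eta> B a \<in> parcs D `` A}" for B A
  have "(parcs ?Q)\<inverse> `` {B} = {A. (A, B) \<in> parcs ?Q}" for B by blast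
  then have tree: "labelled_regular_tree m M ?Q \<psi>"
    using \<eta> infinite_delta_quotient
      delta_quotient_tree[OF Sigma_cosink_subset_delta connected out_neighbours_nonempty]
    by (simp add: labelled_regular_tree_def \<psi>_def[abs_def])
  have bij: "bij_betw (\<eta> B) (Omega M) B" if "B \<in> pverts ?Q" for B using \<eta> that by blast
  have class_of: "B = delta D `` {\<eta> B a}" "\<eta> B a \<in> pverts D" if "B \<in> pverts ?Q" "a \<in> Omega M" for B a
  proof -
    have class_B: "B \<in> pverts D // delta D" using that(1) by (simp add: delta_quotient_def)
    have mem: "\<eta> B a \<in> B" using bij_betw_apply[OF bij[OF that(1)] that(2)] .
    show "B = delta D `` {\<eta> B a}" using class_B mem by (rule delta_class_of_mem)
    show "\<eta> B a \<in> pverts D" using in_quotient_imp_subset[OF equiv_delta class_B] mem by blast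
  qed
  let ?f = "\<lambda>(B, a). \<eta> B a"
  have "bij_betw ?f (pverts ?Q \<times> Omega M) (pverts D)"
    using bij_betw_equiv_classes[OF equiv_delta, of D \<eta> "Omega M"] bij
    by (simp add: delta_quotient_def)
  moreover have "((A, c), (B, a)) \<in> parcs (D_digraph M ?Q \<psi>) \<longleftrightarrow> (\<eta> A c, \<eta> B a) \<in> parcs D"
    if classes: "A \<in> pverts ?Q" "B \<in> pverts ?Q" and in_Omega: "c \<in> Omega M" "a \<in> Omega M" for A B c a
  proof -
    have "parcs D `` A = parcs D `` {\<eta> A c}"
      using class_of[OF classes(1) in_Omega(1)] out_neighbours_delta_class by metis
    moreover have "(A, B) \<in> parcs ?Q" if "(\<eta> A c, \<eta> B a) \<in> parcs D"
      using that class_of classes in_Omega parcs_delta_quotient_iff by metis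
    ultimately show ?thesis using in_Omega by (auto simp: parcs_D_digraph_iff \<psi>_def)
  qed
  ultimately have "dg_isom ?f (with_proj (D_digraph M ?Q \<psi>)) (with_proj D)"
    by (auto simp: dg_isom_def pverts_D_digraph)
  then show ?thesis using tree by blast
qed

theorem digraph_iso_D_digraph:
  assumes T: "labelled_regular_tree m M T \<phi>"
  shows "digraph_iso (with_proj D) (with_proj (D_digraph M T \<phi>))"
proof -
  obtain \<psi> f where Q: "labelled_regular_tree m M (delta_quotient D) \<psi>"
    and f: "dg_isom f (with_proj (D_digraph M (delta_quotient D) \<psi>)) (with_proj D)"
    using ex_D_digraph_delta_quotient by blast
  interpret DQ: pair_wf_digraph "D_digraph M (delta_quotient D) \<psi>"
    using Q by (rule pair_wf_D_digraph)
  have "digraph_iso (with_proj (D_digraph M (delta_quotient D) \<psi>)) (with_proj D)"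
    using f digraph_iso_iff[OF DQ.pair_wf_digraph_axioms pair_wf_digraph_axioms] by blast
  with DQ.wf_digraph_axioms
  have "digraph_iso (with_proj D) (with_proj (D_digraph M (delta_quotient D) \<psi>))"
    by (rule digraph_iso_swap)
  also have "digraph_iso \<dots> (with_proj (D_digraph M T \<phi>))"
    using D_digraph_unique[OF Q T]
      digraph_iso_iff[OF DQ.pair_wf_digraph_axioms pair_wf_D_digraph[OF T]] by blast
  finally show ?thesis .
qed

end

theorem theorem5p8:
  fixes D :: "'a pair_pre_digraph" and m :: nat
  assumes digraph: "pair_loopfree_digraph D"
    and infinite: "infinite (pverts D)"
    and connected: "connected (with_proj D)"
    and distance_transitive: "distance_transitive D"
    and homogeneous: "weakly_descendant_homogeneous D"
    and out_valency: "has_out_valency D m" "1 < m"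
    and no_directed_cycles: "acyclic (parcs D)"
    and not_universal: "\<not> reachability_universal D"
  shows "((\<forall>A\<in>alternets D. class_C A) \<longrightarrow>
            delta_nontrivial_on D (pverts D) \<and>
            directed_tree (delta_quotient D) \<and>
            has_out_valency (delta_quotient D) 1 \<and>
            (\<exists>k. has_in_valency (delta_quotient D) k \<and>
               (\<forall>A\<in>alternets D. card {delta D `` {x} | x. x \<in> sources A} = k)))
         \<and>
         (\<forall>M::enat. enat m \<le> M \<and>
            (\<forall>A\<in>alternets D. digraph_iso (with_proj A) (with_proj (Sigma_digraph m M))) \<longrightarrow>
            (\<forall>(T :: 't pair_pre_digraph) \<phi>. labelled_regular_tree m M T \<phi> \<longrightarrow>
               digraph_iso (with_proj D) (with_proj (D_digraph M T \<phi>))))"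
proof -
  interpret pair_loopfree_digraph D by (rule digraph)
  interpret connected_acyclic_homogeneous_digraph D m
    using connected homogeneous out_valency no_directed_cycles by unfold_locales
  have "digraph_iso (with_proj D) (with_proj (D_digraph M T \<phi>))"
    if "enat m \<le> M" "\<forall>A\<in>alternets D. digraph_iso (with_proj A) (with_proj (Sigma_digraph m M))"
      and "labelled_regular_tree m M T \<phi>"
    for M and T :: "'t pair_pre_digraph" and \<phi>
  proof -
    interpret Sigma_alternets_digraph D m M using that(1,2) by unfold_locales
    show ?thesis using that(3) by (rule digraph_iso_D_digraph)
  qed
  then show ?thesis
    using class_C_delta_nontrivial class_C_delta_quotient_tree class_C_in_valency by blast
qed

end
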